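(* There is a sufficiently large absolute constant $C>0$ such that the following holds. Let $\ell\ge2$ be an integer and let $\epsilon,\phi\in(0,1)$ satisfy $\epsilon=1-\Omega(1)$, $\phi\le\epsilon$, and $\phi\ge C\cdot\max\{\epsilon^2,1/n\}$. Then any streaming algorithm that, given an $n$-vertex graph $G$ in a stream, computes with probability at least $9/10$ an $\ell$-level $(\epsilon,\phi)$-removal-based expander decomposition sequence of $G$ requires $\Omega(n/\epsilon)$ bits of space.
   Context: For a graph $G=(V,E)$ and $A,B\subseteq V$, $E(A,B)$ is the set of edges with one endpoint in $A$ and one in $B$; $\mathrm{vol}_H(S)$ is the sum of degrees in $H$. For a graph $H=(V',E')$ and $\emptyset\ne S\subsetneq V'$, $\Phi_H(S)=|E'(S,V'\setminus S)|/\min\{\mathrm{vol}_H(S),\mathrm{vol}_H(V'\setminus S)\}$; $H$ is a $\psi$-expander if $\Phi_H(S)\ge\psi$ for all such $S$. An $(\epsilon,\phi)$-expander decomposition (ED) of $G=(V,E)$ is a partition $\mathcal U$ of $V$ with $\frac12\sum_{U\in\mathcal U}|E(U,V\setminus U)|\le\epsilon|E|$ and $G[U]$ a $\phi$-expander for all $U\in\mathcal U$. For a partition $\mathcal U$ of $V$, $E\setminus\mathcal U=E\setminus\bigcup_{U\in\mathcal U}\binom{U}{2}$ (inter-cluster edges) and $G\setminus\mathcal U=(V,E\setminus\mathcal U)$. A sequence of partitions $\mathcal U_1,\dots,\mathcal U_\ell$ of $V$ is an $\ell$-level $(\epsilon,\phi)$-removal-based ED sequence of $G$ if, setting $G_1=G$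 and $G_{i+1}=G_i\setminus\mathcal U_i$, each $\mathcal U_i$ is an $(\epsilon,\phi)$-ED of $G_i$ for all $i\in[\ell]$. *)

theory Defs
  imports "HOL-Library.Disjoint_Sets" "HOL-Library.Ramsey"
    "HOL-Probability.Probability_Mass_Function"
begin

text \<open>
  A finite simple graph is a pair of a finite vertex set \<open>V\<close> and an edge set
  \<open>E \<subseteq> [V]\<^bsup>2\<^esup>\<close>, so that edges are two-element sets of vertices.
\<close>

definition edges_between :: "'a set set \<Rightarrow> 'a set \<Rightarrow> 'a set \<Rightarrow> 'a set set" where
  "edges_between E A B = {e \<in> E. \<exists>a\<in>A. \<exists>b\<in>B. e = {a, b}}"

definition degree :: "'a set set \<Rightarrow> 'a \<Rightarrow> nat" where
  "degree E v = card {e \<in> E. v \<in> e}"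

definition vol :: "'a set set \<Rightarrow> 'a set \<Rightarrow> nat" where
  "vol E S = (\<Sum>v\<in>S. degree E v)"

text \<open>
  If one side of the cut has volume 0, the quotient below is \<open>0 / 0 = 0\<close>. Hence, for
  \<open>\<psi> > 0\<close>, a \<open>\<psi>\<close>-expander is connected, and a single vertex is a \<open>\<psi>\<close>-expander.
\<close>

definition conductance :: "'a set \<Rightarrow> 'a set set \<Rightarrow> 'a set \<Rightarrow> real" where
  "conductance V E S =
     real (card (edges_between E S (V - S))) / real (min (vol E S) (vol E (V - S)))"

definition expander :: "real \<Rightarrow> 'a set \<Rightarrow> 'a set set \<Rightarrow> bool" where
  "expander \<psi> V E \<longleftrightarrow> (\<forall>S. S \<noteq> {} \<and> S \<subset> V \<longrightarrow> conductance V E S \<ge> \<psi>)"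

definition induced_edges :: "'a set set \<Rightarrow> 'a set \<Rightarrow> 'a set set" where
  "induced_edges E U = {e \<in> E. e \<subseteq> U}"

definition expander_decomposition ::
    "real \<Rightarrow> real \<Rightarrow> 'a set \<Rightarrow> 'a set set \<Rightarrow> 'a set set \<Rightarrow> bool" where
  "expander_decomposition \<epsilon> \<phi> V E \<U> \<longleftrightarrow>
     partition_on V \<U> \<and>
     1 / 2 * (\<Sum>U\<in>\<U>. real (card (edges_between E U (V - U)))) \<le> \<epsilon> * real (card E) \<and>
     (\<forall>U\<in>\<U>. expander \<phi> U (induced_edges E U))"

definition inter_cluster_edges :: "'a set set \<Rightarrow> 'a set set \<Rightarrow> 'a set set" where
  "inter_cluster_edges E \<U> = E - (\<Union>U\<in>\<U>. [U]\<^bsup>2\<^esup>)"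

text \<open>
  Levels are counted from 0: the list entry \<open>Us ! i\<close> is the partition
  \<open>\<U>\<^sub>i\<^sub>+\<^sub>1\<close>, and \<open>level_edges E Us i\<close> is the edge set of \<open>G\<^sub>i\<^sub>+\<^sub>1\<close>.
\<close>

primrec level_edges :: "'a set set \<Rightarrow> 'a set set list \<Rightarrow> nat \<Rightarrow> 'a set set" where
  "level_edges E Us 0 = E"
| "level_edges E Us (Suc i) = inter_cluster_edges (level_edges E Us i) (Us ! i)"

definition removal_ED_sequence ::
    "nat \<Rightarrow> real \<Rightarrow> real \<Rightarrow> 'a set \<Rightarrow> 'a set set \<Rightarrow> 'a set set list \<Rightarrow> bool" where
  "removal_ED_sequence l \<epsilon> \<phi> V E Us \<longleftrightarrow>
     length Us = l \<and>
     (\<forall>i<l. expander_decomposition \<epsilon> \<phi> V (level_edges E Us i) (Us ! i))"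

text \<open>
  One-pass streaming of the edges of a graph on the vertices \<open>0, \<dots>, n - 1\<close>. The only
  information carried from one edge to the next is the memory content, a bit string; the
  computations within a step and the size of the output are not charged.
\<close>

record streaming_algorithm =
  init :: "bool list"
  update :: "nat set \<Rightarrow> bool list \<Rightarrow> bool list"
  result :: "bool list \<Rightarrow> nat set set list"

definition memory :: "streaming_algorithm \<Rightarrow> nat set list \<Rightarrow> bool list" where
  "memory D \<sigma> = fold (update D) \<sigma> (init D)"

definition run :: "streaming_algorithm \<Rightarrow> nat set list \<Rightarrow> nat set set list" where
  "run D \<sigma> = result D (memory D \<sigma>)"

text \<open>Insertion-only stream: every edge arrives exactly once, in arbitrary order.\<close>

definition stream_of :: "nat set set \<Rightarrow> nat set list \<Rightarrow> bool" where
  "stream_of E \<sigma> \<longleftrightarrow> distinct \<sigma> \<and> set \<sigma> = E"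

text \<open>
  A randomized algorithm is a probability distribution over deterministic ones, i.e.\ it has
  free read-only access to its random string throughout. This includes algorithms that toss
  fresh coins in every step: an edge never arrives twice, so independent coins can be fixed
  in advance for every pair of an edge and a memory content. Since for fixed \<open>n\<close> and
  bounded memory only finitely many behaviours are distinguishable, discrete distributions
  are no restriction.
\<close>

definition uses_space :: "streaming_algorithm pmf \<Rightarrow> nat \<Rightarrow> nat \<Rightarrow> bool" where
  "uses_space A n s \<longleftrightarrow>
     (\<forall>D\<in>set_pmf A. \<forall>E \<sigma>. E \<subseteq> [{..<n}]\<^bsup>2\<^esup> \<and> stream_of E \<sigma> \<longrightarrow> length (memory D \<sigma>) \<le> s)"

definition computes_removal_ED_sequence ::
    "streaming_algorithm pmf \<Rightarrow> nat \<Rightarrow> nat \<Rightarrow> real \<Rightarrow> real \<Rightarrow> real \<Rightarrow> bool" where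
  "computes_removal_ED_sequence A n l \<epsilon> \<phi> p \<longleftrightarrow>
     (\<forall>E \<sigma>. E \<subseteq> [{..<n}]\<^bsup>2\<^esup> \<and> stream_of E \<sigma> \<longrightarrow>
        measure_pmf.prob A {D. removal_ED_sequence l \<epsilon> \<phi> {..<n} E (run D \<sigma>)} \<ge> p)"

end

theory Submission
  imports Defs
begin

text \<open>
  Reduction from one-way communication. Alice holds a subset \<open>X\<close> of the edges of disjoint
  complete bipartite graphs \<open>K\<^sub>t\<^sub>,\<^sub>t\<close>, called blocks, with \<open>t = c / \<epsilon>\<close>; this makes \<open>\<Omega>(n / \<epsilon>)\<close> bits.
  The blocks come in groups of about \<open>z\<close> vertices each, with \<open>z \<approx> 2 / \<phi>\<close>. Bob picks a block and a
  vertex \<open>u\<close> on its left side, the same ones in every group. He attaches \<open>u\<close> to one dense bipartite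
  graph of volume about \<open>t z\<close>, and the rest of the block to another one, so that the only edges
  between the two parts are those from \<open>u\<close> to its at most \<open>t\<close> neighbours in the block. Since
  \<open>t / (t z / 2) < \<phi>\<close>, these edges are cut at level 1. At this level at most
  \<open>\<epsilon> |E| = O(\<epsilon> t z)\<close> edges per group are removed, too few to break up the dense parts, and as
  \<open>\<phi> \<ge> C \<epsilon>\<^sup>2\<close> makes this small compared to \<open>t\<^sup>2\<close>, most vertices \<open>v\<close> on the right side stay with the
  rest of the block. Then \<open>v\<close> has no edge in \<open>G\<^sub>2\<close> other than \<open>uv\<close>. Only \<open>\<epsilon>\<^sup>2 |E| = O(\<epsilon>\<^sup>2 t z)\<close> edges per
  group are cut at level 2, so that in most cases \<open>u\<close> and \<open>v\<close> share a cluster of \<open>\<U>\<^sub>2\<close> iff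
  \<open>uv \<in> X\<close>. Hence Bob's view of Alice's message determines \<open>X\<close> up to a small constant fraction of the
  bits, on average over \<open>X\<close>, and this needs linearly many bits.
\<close>

section \<open>Sets described up to small distortion\<close>

lemma sum_half_power_card:
  assumes "finite H"
  shows "(\<Sum>X\<in>Pow H. (1/2::real) ^ card X) = (3/2) ^ card H"
proof -
  have "(3/2::real) ^ card H = (\<Prod>i\<in>H. 1/2 + 1)"
    by simp
  also have "\<dots> = (\<Sum>X\<in>Pow H. (\<Prod>i\<in>X. 1/2) * (\<Prod>i\<in>H - X. 1))"
    by (rule prod_add [OF assms])
  finally show ?thesis
    by simp
qed

text \<open>The map \<open>X \<mapsto> sym_diff X Y\<close> is an involution of
  \<open>Pow H\<close>, so the sum does not depend on the centre \<open>Y\<close>.\<close>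

lemma sum_half_power_card_sym_diff:
  assumes "finite H" "Y \<subseteq> H"
  shows "(\<Sum>X\<in>Pow H. (1/2::real) ^ card (sym_diff X Y)) = (3/2) ^ card H"
proof -
  have "(\<Sum>X\<in>Pow H. (1/2::real) ^ card (sym_diff X Y)) = (\<Sum>X\<in>Pow H. (1/2) ^ card X)"
    by (rule sum.reindex_bij_witness [of _ "\<lambda>X. sym_diff X Y" "\<lambda>X. sym_diff X Y"])
      (use \<open>Y \<subseteq> H\<close> in \<open>auto intro: arg_cong [where f = card]\<close>)
  then show ?thesis
    using sum_half_power_card [OF \<open>finite H\<close>] by simp
qed

text \<open>By convexity, \<open>(1/2) ^ d\<close> lies above its tangent at \<open>a\<close>.
  Summed over many \<open>d\<close>, this is Jensen's inequality: a bound on the average distance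
  suffices.\<close>

lemma half_power_ge_tangent:
  fixes a :: real
  shows "(1/2) ^ d \<ge> (1/2) powr a * (1 - ln 2 * (real d - a))"
proof -
  have "(1/2::real) ^ d = (1/2) powr a * exp (- (ln 2 * (real d - a)))"
  proof -
    have "exp (- (ln 2 * (real d - a))) = (1/2::real) powr (real d - a)"
      by (simp add: powr_def ln_div)
    then show ?thesis
      by (simp add: powr_add [symmetric] powr_realpow)
  qed
  moreover have "exp (- (ln 2 * (real d - a))) \<ge> 1 - ln 2 * (real d - a)"
    using exp_ge_add_one_self [of "- (ln 2 * (real d - a))"] by simp
  ultimately show ?thesis
    by simp
qed

text \<open>Count the weight \<open>(1/2) ^ card (sym_diff X Y)\<close> over all \<open>X\<close>
  and all \<open>Y\<close> in the image in two ways. Each \<open>Y\<close> receives exactly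
  \<open>(3/2) ^ card H\<close>, while the single term \<open>Y = F X\<close> already gives, by
  convexity, at least \<open>(1/2) powr a\<close> per \<open>X\<close> on average.\<close>

lemma card_image_ge_of_small_distortion:
  fixes F :: "'a set \<Rightarrow> 'a set"
  assumes "finite H"
    and F: "\<And>X. X \<subseteq> H \<Longrightarrow> F X \<subseteq> H"
    and dist: "(\<Sum>X\<in>Pow H. real (card (sym_diff X (F X)))) \<le> 2 ^ card H * a"
  shows "real (card (F ` Pow H)) * (3/2) ^ card H \<ge> 2 ^ card H * (1/2) powr a"
proof -
  let ?d = "\<lambda>X. card (sym_diff X (F X))"
  \<comment> \<open>The linear parts of the tangents add up to the excess of the total distance over
    \<open>2 ^ card H * a\<close>, which is not positive.\<close>
  have "2 ^ card H * (1/2) powr a \<le>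
      (1/2) powr a * (2 ^ card H - ln 2 * ((\<Sum>X\<in>Pow H. real (?d X)) - 2 ^ card H * a))"
    using dist by (simp add: mult_le_0_iff)
  also have "\<dots> = (\<Sum>X\<in>Pow H. (1/2) powr a * (1 - ln 2 * (real (?d X) - a)))"
    using \<open>finite H\<close>
    by (simp add: sum_distrib_left [symmetric] sum_subtractf card_Pow)
  also have "\<dots> \<le> (\<Sum>X\<in>Pow H. (1/2) ^ ?d X)"
    by (intro sum_mono half_power_ge_tangent)
  also have "\<dots> \<le> (\<Sum>X\<in>Pow H. \<Sum>Y\<in>F ` Pow H. (1/2) ^ card (sym_diff X Y))"
  proof (rule sum_mono)
    fix X assume "X \<in> Pow H"
    then show "(1/2::real) ^ ?d X \<le> (\<Sum>Y\<in>F ` Pow H. (1/2) ^ card (sym_diff X Y))"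
      using \<open>finite H\<close>
      by (intro member_le_sum [of "F X" _ "\<lambda>Y. (1/2::real) ^ card (sym_diff X Y)"]) auto
  qed
  also have "\<dots> = (\<Sum>Y\<in>F ` Pow H. \<Sum>X\<in>Pow H. (1/2) ^ card (sym_diff X Y))"
    by (rule sum.swap)
  also have "\<dots> = (\<Sum>Y\<in>F ` Pow H. (3/2) ^ card H)"
    using F \<open>finite H\<close> by (intro sum.cong sum_half_power_card_sym_diff refl) auto
  finally show ?thesis
    by simp
qed

lemma card_le_bits_of_small_distortion:
  fixes F :: "'a set \<Rightarrow> 'a set"
  assumes "finite H"
    and "\<And>X. X \<subseteq> H \<Longrightarrow> F X \<subseteq> H"
    and "(\<Sum>X\<in>Pow H. real (card (sym_diff X (F X)))) \<le> 2 ^ card H * (real (card H) / 5)"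
    and image: "card (F ` Pow H) \<le> 2 ^ k"
  shows "card H \<le> 5 * k"
proof -
  let ?N = "card H"
  have "2 ^ ?N * (1/2::real) powr (real ?N / 5) \<le> real (card (F ` Pow H)) * (3/2) ^ ?N"
    by (rule card_image_ge_of_small_distortion) (use assms in auto)
  also have "\<dots> \<le> 2 ^ k * (3/2) ^ ?N"
    using image by (intro mult_right_mono) (simp_all flip: of_nat_power)
  \<comment> \<open>The fifth power makes the exponent \<open>?N / 5\<close> integral.\<close>
  finally have "(2 ^ ?N * (1/2::real) powr (real ?N / 5)) ^ 5 \<le> (2 ^ k * (3/2) ^ ?N) ^ 5"
    by (intro power_mono) auto
  moreover have "((1/2::real) powr (real ?N / 5)) ^ 5 = (1/2) ^ ?N"
    by (simp add: powr_realpow [symmetric] powr_powr)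
  ultimately have "(2 ^ ?N) ^ 5 * (1/2::real) ^ ?N \<le> (2 ^ k) ^ 5 * ((3/2) ^ ?N) ^ 5"
    by (simp add: power_mult_distrib)
  also have "((3/2::real) ^ ?N) ^ 5 = ((3/2) ^ 5) ^ ?N"
    by (simp add: power_mult [symmetric] mult.commute)
  \<comment> \<open>Here \<open>(3/2) ^ 5 = 243/32 < 8\<close>, whereas the left side has base
    \<open>2 ^ 5 / 2 = 16\<close>; a factor \<open>2 ^ ?N\<close> remains.\<close>
  also have "(2 ^ k) ^ 5 * ((3/2::real) ^ 5) ^ ?N \<le> (2 ^ k) ^ 5 * 8 ^ ?N"
    by (intro mult_left_mono power_mono) (auto simp: power_divide)
  also have "(2 ^ ?N) ^ 5 * (1/2::real) ^ ?N = 2 ^ ?N * 8 ^ ?N"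
  proof -
    have "(2 ^ ?N) ^ 5 = (2 ^ 5 :: real) ^ ?N"
      by (simp only: power_mult [symmetric] mult.commute)
    then have "(2 ^ ?N) ^ 5 * (1/2::real) ^ ?N = (2 ^ 5 * (1/2)) ^ ?N"
      by (simp only: power_mult_distrib)
    also have "\<dots> = (2 * 8) ^ ?N"
      by simp
    finally show ?thesis
      by (simp only: power_mult_distrib)
  qed
  finally have "(2::real) ^ ?N \<le> 2 ^ (5 * k)"
    by (simp add: power_mult [symmetric] mult.commute)
  then show ?thesis
    by simp
qed

lemma card_bool_lists_length_le: "card {xs :: bool list. length xs \<le> s} \<le> 2 ^ (s + 1)"
proof -
  have "card {xs :: bool list. length xs \<le> s} = (\<Sum>i\<le>s. 2 ^ i)"
    using card_lists_length_le [of "UNIV :: bool set" s] by (simp add: card_UNIV_bool)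
  also have "\<dots> = 2 ^ (s + 1) - (1::nat)"
    using mask_eq_sum_exp_nat [of "s + 1"] by (simp add: lessThan_Suc_atMost flip: lessThan_def)
  finally show ?thesis
    by simp
qed

section \<open>Partitions into clusters\<close>

lemma inter_cluster_edges_iff:
  assumes "e \<in> E \<Longrightarrow> e \<in> [V]\<^bsup>2\<^esup>"
  shows "e \<in> inter_cluster_edges E \<U> \<longleftrightarrow> e \<in> E \<and> (\<forall>Q\<in>\<U>. \<not> e \<subseteq> Q)"
  using assms by (auto simp: inter_cluster_edges_def nsets_def)

text \<open>Double counting: an edge between clusters lies in the boundary of the clusters of both
  its endpoints. This matches the factor 1/2 in \<open>expander_decomposition\<close>.\<close>

lemma card_inter_cluster_edges_le:
  assumes part: "partition_on V \<U>" and "finite V" and E: "E \<subseteq> [V]\<^bsup>2\<^esup>"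
  shows "2 * card (inter_cluster_edges E \<U>) \<le> (\<Sum>U\<in>\<U>. card (edges_between E U (V - U)))"
proof -
  let ?I = "inter_cluster_edges E \<U>" and ?b = "\<lambda>U. edges_between E U (V - U)"
  have "finite E"
    using E \<open>finite V\<close> finite_imp_finite_nsets finite_subset by blast
  have "finite \<U>"
    using finite_elements [OF \<open>finite V\<close> part] .
  have two: "2 \<le> card {U \<in> \<U>. e \<in> ?b U}" if "e \<in> ?I" for e
  proof -
    have "e \<in> E" and split: "\<And>Q. Q \<in> \<U> \<Longrightarrow> \<not> e \<subseteq> Q"
      using that inter_cluster_edges_iff [of e E V \<U>] E by auto
    then have "e \<in> [V]\<^bsup>2\<^esup>"
      using E by blast
    then obtain a b where e: "e = {a, b}" "a \<in> V" "b \<in> V"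
      by (auto simp: nsets_2_eq)
    then obtain A B where AB: "A \<in> \<U>" "a \<in> A" "B \<in> \<U>" "b \<in> B"
      using part by (auto simp: partition_on_def)
    with e split have "b \<notin> A" "a \<notin> B"
      by auto
    with AB e have "e \<in> ?b A" "e \<in> ?b B" "A \<noteq> B"
      using \<open>e \<in> E\<close> by (auto simp: edges_between_def)
    then have "{A, B} \<subseteq> {U \<in> \<U>. e \<in> ?b U}" "card {A, B} = 2"
      using AB by auto
    then show ?thesis
      using card_mono [of "{U \<in> \<U>. e \<in> ?b U}" "{A, B}"] \<open>finite \<U>\<close> by simp
  qed
  have "2 * card ?I = (\<Sum>e\<in>?I. 2)"
    by simp
  also have "\<dots> \<le> (\<Sum>e\<in>?I. card {U \<in> \<U>. e \<in> ?b U})"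
    by (intro sum_mono two)
  also have "\<dots> = (\<Sum>e\<in>?I. \<Sum>U\<in>\<U>. of_bool (e \<in> ?b U))"
    using \<open>finite \<U>\<close> by (simp add: sum.If_cases of_bool_def Int_def)
  also have "\<dots> = (\<Sum>U\<in>\<U>. \<Sum>e\<in>?I. of_bool (e \<in> ?b U))"
    by (rule sum.swap)
  also have "\<dots> \<le> (\<Sum>U\<in>\<U>. card (?b U))"
  proof (rule sum_mono)
    fix U
    have "finite ?I" "finite (?b U)"
      using \<open>finite E\<close> by (auto simp: inter_cluster_edges_def edges_between_def)
    then show "(\<Sum>e\<in>?I. of_bool (e \<in> ?b U)) \<le> card (?b U)"
      by (auto simp: of_bool_def sum.If_cases intro: card_mono)
  qed
  finally show ?thesis .
qed

lemma expander_decomposition_card_inter_cluster_edges: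
  assumes "expander_decomposition \<epsilon> \<phi> V E \<U>" "finite V" "E \<subseteq> [V]\<^bsup>2\<^esup>"
  shows "real (card (inter_cluster_edges E \<U>)) \<le> \<epsilon> * real (card E)"
proof -
  have "real (2 * card (inter_cluster_edges E \<U>)) \<le>
      real (\<Sum>U\<in>\<U>. card (edges_between E U (V - U)))"
    using assms card_inter_cluster_edges_le
    unfolding expander_decomposition_def of_nat_le_iff by blast
  then show ?thesis
    using assms(1) by (simp add: expander_decomposition_def)
qed

text \<open>
  Each element of \<open>B\<close> would be separated from \<open>a\<close> or from \<open>a'\<close>.
\<close>

lemma same_cluster_of_common_neighbours:
  assumes part: "partition_on V \<U>" and a: "a \<in> V" "a' \<in> V" and "finite B"
    and nbr: "\<And>b. b \<in> B \<Longrightarrow> {a, b} \<in> F \<and> {a', b} \<in> F"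
    and disj: "a \<notin> B" "a' \<notin> B"
    and few: "card {e \<in> F. \<forall>Q\<in>\<U>. \<not> e \<subseteq> Q} < card B" and "finite F"
  shows "\<exists>Q\<in>\<U>. a \<in> Q \<and> a' \<in> Q"
proof (rule ccontr)
  assume contra: "\<not> ?thesis"
  \<comment> \<open>\<open>c b\<close> is an edge from \<open>b\<close> to \<open>a\<close> or
    \<open>a'\<close> that is cut: if \<open>b\<close> shares a cluster with \<open>a\<close>, it
    cannot share one with \<open>a'\<close>.\<close>
  define c where "c b = (if \<exists>Q\<in>\<U>. {a, b} \<subseteq> Q then {a', b} else {a, b})" for b
  have uniq: "Q = Q'" if "Q \<in> \<U>" "Q' \<in> \<U>" "b \<in> Q" "b \<in> Q'" for Q Q' b
    using partition_onD2 [OF part] that by (auto dest: disjointD)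
  have "c b \<in> F \<and> (\<forall>Q\<in>\<U>. \<not> c b \<subseteq> Q)" if "b \<in> B" for b
  proof (cases "\<exists>Q\<in>\<U>. {a, b} \<subseteq> Q")
    case True
    then obtain Q where Q: "Q \<in> \<U>" "a \<in> Q" "b \<in> Q"
      by auto
    have "\<not> {a', b} \<subseteq> Q'" if "Q' \<in> \<U>" for Q'
      using that Q uniq [of Q Q' b] contra by blast
    then show ?thesis
      using True nbr \<open>b \<in> B\<close> by (simp add: c_def)
  next
    case False
    then have "c b = {a, b}"
      unfolding c_def by (rule if_not_P)
    then show ?thesis
      using False nbr that by simp
  qed
  then have "c ` B \<subseteq> {e \<in> F. \<forall>Q\<in>\<U>. \<not> e \<subseteq> Q}"
    by blast
  \<comment> \<open>The endpoint \<open>b\<close> can be read off from \<open>c b\<close> because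
    neither \<open>a\<close> nor \<open>a'\<close> lies in \<open>B\<close>.\<close>
  moreover have "inj_on c B"
    using disj by (auto simp: inj_on_def c_def doubleton_eq_iff split: if_splits)
  ultimately have "card B \<le> card {e \<in> F. \<forall>Q\<in>\<U>. \<not> e \<subseteq> Q}"
    using \<open>finite F\<close> by (intro card_inj_on_le [of c]) auto
  with few show False
    by simp
qed

lemma card_doubletons:
  assumes "A \<inter> B = {}"
  shows "card ((\<lambda>(a, b). {a, b}) ` (A \<times> B)) = card A * card B"
proof -
  have "inj_on (\<lambda>(a, b). {a, b}) (A \<times> B)"
    using assms by (auto simp: inj_on_def doubleton_eq_iff)
  then show ?thesis
    by (simp add: card_image card_cartesian_product)
qed

text \<open>As \<open>Q\<close> is the only cluster that meets \<open>A\<close>, all edges of the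
  complete bipartite graph between \<open>A\<close> and \<open>B - Q\<close> are cut.\<close>

lemma card_separated_le:
  assumes part: "partition_on V \<U>" and Q: "Q \<in> \<U>" "A \<subseteq> Q" and "A \<inter> B = {}"
    and nbr: "\<And>a b. a \<in> A \<Longrightarrow> b \<in> B \<Longrightarrow> {a, b} \<in> F" and "finite F"
  shows "card A * card (B - Q) \<le> card {e \<in> F. \<forall>Q\<in>\<U>. \<not> e \<subseteq> Q}"
proof -
  have "Q' = Q" if "Q' \<in> \<U>" "a \<in> Q'" "a \<in> A" for Q' a
    using partition_onD2 [OF part] that Q by (auto dest: disjointD)
  then have "(\<lambda>(a, b). {a, b}) ` (A \<times> (B - Q)) \<subseteq> {e \<in> F. \<forall>Q\<in>\<U>. \<not> e \<subseteq> Q}"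
    using nbr by fastforce
  then have "card ((\<lambda>(a, b). {a, b}) ` (A \<times> (B - Q))) \<le> card {e \<in> F. \<forall>Q\<in>\<U>. \<not> e \<subseteq> Q}"
    using \<open>finite F\<close> by (intro card_mono) auto
  moreover have "A \<inter> (B - Q) = {}"
    using \<open>A \<inter> B = {}\<close> by auto
  ultimately show ?thesis
    by (simp add: card_doubletons)
qed

section \<open>Volumes and sparse cuts inside a cluster\<close>

lemma vol_ge_complete_bipartite:
  assumes "finite E" "finite S" "B \<subseteq> S" "A \<inter> B = {}"
    and nbr: "\<And>a b. a \<in> A \<Longrightarrow> b \<in> B \<Longrightarrow> {a, b} \<in> E"
  shows "card A * card B \<le> vol E S"
proof -
  have deg: "card A \<le> degree E b" if "b \<in> B" for b
    unfolding degree_def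
  proof (rule card_inj_on_le)
    show "inj_on (\<lambda>a. {a, b}) A"
      using that \<open>A \<inter> B = {}\<close> by (auto simp: inj_on_def doubleton_eq_iff)
    show "(\<lambda>a. {a, b}) ` A \<subseteq> {e \<in> E. b \<in> e}"
      using nbr that by auto
  qed (use \<open>finite E\<close> in auto)
  have "card A * card B = (\<Sum>b\<in>B. card A)"
    by simp
  also have "\<dots> \<le> (\<Sum>b\<in>B. degree E b)"
    by (intro sum_mono deg)
  also have "\<dots> \<le> vol E S"
    unfolding vol_def using assms by (intro sum_mono2) auto
  finally show ?thesis .
qed

lemma expander_cut_ge:
  assumes "expander \<phi> U E" "S \<noteq> {}" "S \<subset> U" "\<phi> > 0"
    and "real m \<le> real (vol E S)" "real m \<le> real (vol E (U - S))"
  shows "\<phi> * real m \<le> real (card (edges_between E S (U - S)))"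
proof -
  let ?c = "real (card (edges_between E S (U - S)))" and ?v = "real (min (vol E S) (vol E (U - S)))"
  have "\<phi> \<le> ?c / ?v"
    using assms by (auto simp: expander_def conductance_def)
  \<comment> \<open>For \<open>?v = 0\<close> the quotient would be 0 by the convention for
    division, contradicting \<open>\<phi> > 0\<close>.\<close>
  moreover have "?v > 0"
    using calculation \<open>\<phi> > 0\<close> by (cases "?v = 0") auto
  ultimately have "\<phi> * ?v \<le> ?c"
    by (simp add: field_simps)
  moreover have "\<phi> * real m \<le> \<phi> * ?v"
    using assms by (intro mult_left_mono) auto
  ultimately show ?thesis
    by linarith
qed

text \<open>The cut \<open>{v}\<close> has volume 0 and hence conductance 0. This is what separates
  \<open>u\<close> and \<open>v\<close> at level 2 when \<open>uv\<close> is not an edge.\<close>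

lemma expander_isolated_vertex:
  assumes "expander \<phi> U E" "\<phi> > 0" "v \<in> U" "\<And>e. e \<in> E \<Longrightarrow> v \<notin> e"
  shows "U = {v}"
proof (rule ccontr)
  assume "U \<noteq> {v}"
  with \<open>v \<in> U\<close> have "\<phi> \<le> conductance U E {v}"
    using assms(1) by (auto simp: expander_def)
  moreover have "degree E v = 0"
    unfolding degree_def using assms(4) by (metis (no_types, lifting) Collect_empty_eq card.empty)
  ultimately show False
    using \<open>\<phi> > 0\<close> by (simp add: conductance_def vol_def)
qed

text \<open>
  The edges of \<open>A \<union> W\<close> to the outside are at most \<open>card C\<close> many, while both sides of this cut
  have volume of order \<open>t * z\<close>; so a \<open>\<phi>\<close>-expander with \<open>\<phi> > 2 / z\<close> cannot contain
  both.
\<close>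

lemma sparse_cut_is_separated:
  fixes \<phi> :: real
  assumes part: "partition_on Vs \<U>" and expd: "\<And>Q. Q \<in> \<U> \<Longrightarrow> expander \<phi> Q (induced_edges E Q)"
    and fin: "finite Vs" "finite E" and F: "F \<subseteq> E"
    and sub: "A \<subseteq> Vs" "W \<subseteq> Vs" "P \<subseteq> Vs" "Z \<subseteq> Vs" "C \<subseteq> Vs"
    and disj: "A \<inter> W = {}" "(A \<union> W) \<inter> (P \<union> Z) = {}" "P \<inter> Z = {}" "C \<inter> R = {}"
    and mem: "u \<in> A" "R \<subseteq> P"
    and AW: "\<And>a w. a \<in> A \<Longrightarrow> w \<in> W \<Longrightarrow> {a, w} \<in> F"
    and PZ: "\<And>p x. p \<in> P \<Longrightarrow> x \<in> Z \<Longrightarrow> {p, x} \<in> F"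
    and RC: "\<And>r v. r \<in> R \<Longrightarrow> v \<in> C \<Longrightarrow> {r, v} \<in> F"
    and cut: "\<And>x y. x \<in> A \<union> W \<Longrightarrow> y \<notin> A \<union> W \<Longrightarrow> {x, y} \<in> E \<Longrightarrow> x = u \<and> y \<in> C"
    and card: "card A \<ge> t" "card R = t" "card W = z" "card Z = z" "card C \<le> t"
    and t: "t \<ge> 2" and \<phi>: "\<phi> * real z > 2"
    and few: "card {e \<in> F. \<forall>Q\<in>\<U>. \<not> e \<subseteq> Q} < z"
  shows "\<exists>Q\<in>\<U>. P \<subseteq> Q \<and> u \<notin> Q \<and> t * card (C - Q) \<le> card {e \<in> F. \<forall>Q\<in>\<U>. \<not> e \<subseteq> Q}"
proof -
  let ?d = "card {e \<in> F. \<forall>Q\<in>\<U>. \<not> e \<subseteq> Q}"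
  have finF: "finite F"
    using fin F finite_subset by blast
  have finV: "finite A" "finite W" "finite P" "finite Z" "finite C" "finite R"
    using fin sub mem finite_subset by metis+
  have uniq: "Q = Q'" if "Q \<in> \<U>" "Q' \<in> \<U>" "x \<in> Q" "x \<in> Q'" for Q Q' x
    using partition_onD2 [OF part] that by (auto dest: disjointD)
  \<comment> \<open>Two vertices of \<open>X\<close> have \<open>z\<close> common neighbours, but
    fewer than \<open>z\<close> edges of \<open>F\<close> are cut.\<close>
  have one_cluster: "\<exists>Q\<in>\<U>. X \<subseteq> Q"
    if X: "X \<subseteq> Vs" "x \<in> X" and B: "X \<inter> B = {}" "finite B" "card B = z"
      and XB: "\<And>x b. x \<in> X \<Longrightarrow> b \<in> B \<Longrightarrow> {x, b} \<in> F" for X x B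
  proof -
    obtain Q where Q: "Q \<in> \<U>" "x \<in> Q"
      using part X by (auto simp: partition_on_def)
    have "y \<in> Q" if "y \<in> X" for y
    proof -
      have "\<exists>Q'\<in>\<U>. x \<in> Q' \<and> y \<in> Q'"
        by (rule same_cluster_of_common_neighbours [OF part, where B = B and F = F])
          (use X B XB that few finF in auto)
      then show ?thesis
        using uniq Q by blast
    qed
    then show ?thesis
      using Q by blast
  qed
  \<comment> \<open>Each vertex of \<open>B - Q\<close> costs at least \<open>t \<ge> 2\<close> cut
    edges, so fewer than \<open>z / 2\<close> vertices of \<open>B\<close> are outside
    \<open>Q\<close>; \<open>(z + 1) div 2\<close> is \<open>z / 2\<close> rounded up.\<close>
  have half: "(z + 1) div 2 \<le> card (B \<inter> Q)"
    if "Q \<in> \<U>" "X \<subseteq> Q" "X \<inter> B = {}" "finite B" "card B = z" "t \<le> card X"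
      and "\<And>x b. x \<in> X \<Longrightarrow> b \<in> B \<Longrightarrow> {x, b} \<in> F" for B X Q
  proof -
    have "t * card (B - Q) \<le> card X * card (B - Q)"
      using that by simp
    also have "\<dots> \<le> ?d"
      using card_separated_le [OF part \<open>Q \<in> \<U>\<close> \<open>X \<subseteq> Q\<close> \<open>X \<inter> B = {}\<close>, of F] that finF by blast
    finally have "2 * card (B - Q) < z"
      using few t by (meson le_less_trans mult_le_mono1)
    moreover have "card B = card (B - Q) + card (B \<inter> Q)"
      using \<open>finite B\<close> by (metis Diff_disjoint Int_commute Un_Diff_Int card_Un_disjoint
          finite_Diff finite_Int inf_left_commute inf_bot_right inf_assoc)
    ultimately show ?thesis
      using \<open>card B = z\<close> by linarith
  qed
  obtain Q where Q: "Q \<in> \<U>" "A \<subseteq> Q"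
    using one_cluster [of A u W] sub mem disj AW finV card by blast
  obtain r where r: "r \<in> R"
    using card t by (metis card.empty ex_in_conv not_numeral_le_zero)
  obtain P' where P': "P' \<in> \<U>" "P \<subseteq> P'"
    using one_cluster [of P r Z] r sub mem disj PZ finV card by blast
  have tP: "t \<le> card P"
    using card mem finV by (metis card_mono)
  \<comment> \<open>Otherwise one cluster contains \<open>A\<close> and \<open>P\<close> together
    with at least half of \<open>W\<close> and of \<open>Z\<close>, and the cut along
    \<open>A \<union> W\<close> violates expansion.\<close>
  have "u \<notin> P'"
  proof
    assume "u \<in> P'"
    then have [simp]: "P' = Q"
      using uniq P' Q mem by blast
    let ?S = "(A \<union> W) \<inter> Q" and ?EQ = "induced_edges E Q" and ?k = "(z + 1) div 2"
    have "r \<in> Q - (A \<union> W)"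
      using mem P' r disj by auto
    then have S: "?S \<noteq> {}" "?S \<subset> Q"
      using mem Q by auto
    have "finite Q"
      using part Q fin by (metis Union_upper finite_subset partition_onD1)
    have finE: "finite ?EQ"
      using fin by (simp add: induced_edges_def)
    have vol1: "t * ?k \<le> vol ?EQ ?S"
    proof -
      have "t * ?k \<le> card A * card (W \<inter> Q)"
        using half [of Q A W] Q disj finV card AW by (intro mult_le_mono) auto
      also have "\<dots> \<le> vol ?EQ ?S"
      proof (rule vol_ge_complete_bipartite [OF finE])
        show "{a, w} \<in> ?EQ" if "a \<in> A" "w \<in> W \<inter> Q" for a w
          using AW [of a w] that F Q by (auto simp: induced_edges_def)
      qed (use disj \<open>finite Q\<close> in auto)
      finally show ?thesis .
    qed
    have vol2: "t * ?k \<le> vol ?EQ (Q - ?S)"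
    proof -
      have "t * ?k \<le> card P * card (Z \<inter> Q)"
        using half [of Q P Z] P' Q disj finV card PZ tP by (intro mult_le_mono) auto
      also have "\<dots> \<le> vol ?EQ (Q - ?S)"
      proof (rule vol_ge_complete_bipartite [OF finE])
        show "{p, x} \<in> ?EQ" if "p \<in> P" "x \<in> Z \<inter> Q" for p x
          using PZ [of p x] that F Q P' by (auto simp: induced_edges_def)
        show "Z \<inter> Q \<subseteq> Q - ?S"
          using disj by blast
      qed (use disj \<open>finite Q\<close> in auto)
      finally show ?thesis .
    qed
    have "z > 0"
      using few by simp
    then have "\<phi> > 0"
      using \<phi> by (smt (verit) mult_nonneg_nonneg mult_nonpos_nonneg of_nat_0_le_iff)
    have "edges_between ?EQ ?S (Q - ?S) \<subseteq> (\<lambda>v. {u, v}) ` C"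
      using cut by (fastforce simp: edges_between_def induced_edges_def)
    then have "card (edges_between ?EQ ?S (Q - ?S)) \<le> t"
      using card finV by (meson card_image_le card_mono finite_imageI le_trans)
    moreover have "\<phi> * real (t * ?k) \<le> real (card (edges_between ?EQ ?S (Q - ?S)))"
      by (rule expander_cut_ge [OF expd [OF \<open>Q \<in> \<U>\<close>] S \<open>\<phi> > 0\<close>])
        (use vol1 vol2 in \<open>simp_all only: of_nat_le_iff\<close>)
    \<comment> \<open>Half of \<open>z\<close> is exactly what the assumption
      \<open>\<phi> * real z > 2\<close> can afford.\<close>
    moreover have "real t < \<phi> * real (t * ?k)"
    proof -
      have "2 * real ?k \<ge> real z"
        by linarith
      then have "\<phi> * (2 * real ?k) > 2"
        using \<phi> \<open>\<phi> > 0\<close> by (smt (verit) mult_left_mono)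
      then show ?thesis
        using t by (simp add: mult.left_commute)
    qed
    ultimately show False
      by linarith
  qed
  moreover have "t * card (C - P') \<le> ?d"
    using card_separated_le [OF part \<open>P' \<in> \<U>\<close>, of R C F] P' mem disj RC finF card by blast
  ultimately show ?thesis
    using P' by blast
qed

section \<open>One-way communication\<close>

text \<open>The averaging half of Yao's principle: the expected number of successes is at least
  \<open>p * card I\<close>, and some algorithm in the support reaches it.\<close>

lemma pmf_ex_many:
  assumes "finite I" and p: "\<And>i. i \<in> I \<Longrightarrow> p \<le> measure_pmf.prob A {D. P D i}"
  shows "\<exists>D\<in>set_pmf A. p * real (card I) \<le> real (card {i \<in> I. P D i})"
proof -
  let ?g = "\<lambda>D. card {i \<in> I. P D i}"
  have "?g ` set_pmf A \<subseteq> {..card I}"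
    using \<open>finite I\<close> by (auto intro: card_mono)
  then have fin: "finite (?g ` set_pmf A)"
    by (rule finite_subset) simp
  \<comment> \<open>The support may be infinite, but the success counts are at most
    \<open>card I\<close>, so their maximum is attained.\<close>
  then obtain D where D: "D \<in> set_pmf A" "?g D = Max (?g ` set_pmf A)"
    using Max_in [OF fin] set_pmf_not_empty [of A] by (metis (no_types, lifting) image_iff image_is_empty)
  have g: "real (?g D) = (\<Sum>i\<in>I. indicator {D. P D i} D)" for D
    using \<open>finite I\<close> by (simp add: indicator_def sum.If_cases Int_def)
  have "p * real (card I) = (\<Sum>i\<in>I. p)"
    by simp
  also have "\<dots> \<le> (\<Sum>i\<in>I. measure_pmf.prob A {D. P D i})"
    by (intro sum_mono p)
  also have "\<dots> = measure_pmf.expectation A (\<lambda>D. \<Sum>i\<in>I. indicator {D. P D i} D)"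
    by (subst Bochner_Integration.integral_sum)
      (auto simp: measure_pmf.emeasure_eq_measure)
  also have "\<dots> \<le> real (?g D)"
  proof (rule measure_pmf.integral_le_const)
    show "AE x in measure_pmf A. (\<Sum>i\<in>I. indicator {D. P D i} x) \<le> real (?g D)"
      unfolding g [symmetric] AE_measure_pmf_iff using D fin by simp
  qed (auto simp: measure_pmf.emeasure_eq_measure)
  finally show ?thesis
    using D by blast
qed

lemma memory_append: "memory D (\<sigma> @ \<tau>) = fold (update D) \<tau> (memory D \<sigma>)"
  by (simp add: memory_def)

text \<open>
  One-way communication: \<open>X \<subseteq> H\<close> is Alice's input, and Bob, who holds \<open>q\<close>, appends the edges
  \<open>bob q\<close> and wants to learn \<open>X \<inter> T q\<close> up to a tenth of \<open>T q\<close>.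
\<close>

lemma card_le_space_of_decoding:
  fixes T bob :: "'q \<Rightarrow> nat set set"
  assumes space: "uses_space A n s" and H: "H \<subseteq> [{..<n}]\<^bsup>2\<^esup>"
    and Qs: "finite Qs"
    and bob: "\<And>q. q \<in> Qs \<Longrightarrow> bob q \<subseteq> [{..<n}]\<^bsup>2\<^esup> \<and> bob q \<inter> H = {}"
    and success: "\<And>E \<sigma>. E \<subseteq> [{..<n}]\<^bsup>2\<^esup> \<Longrightarrow> stream_of E \<sigma> \<Longrightarrow>
      9/10 \<le> measure_pmf.prob A {D. good E (run D \<sigma>)}"
    and T: "H = (\<Union>q\<in>Qs. T q)" "disjoint_family_on T Qs" "\<And>q. q \<in> Qs \<Longrightarrow> card (T q) = \<tau>"
    and decode: "\<And>X q out. X \<subseteq> H \<Longrightarrow> q \<in> Qs \<Longrightarrow> good (X \<union> bob q) out \<Longrightarrow>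
      10 * card {e \<in> T q. (e \<in> X) \<noteq> (e \<in> dec q out)} \<le> \<tau>"
  shows "card H \<le> 5 * (s + 1)"
proof -
  let ?V2 = "[{..<n}]\<^bsup>2\<^esup>"
  have finV2: "finite ?V2"
    by (simp add: finite_imp_finite_nsets)
  define str where "str X = (SOME \<sigma>. stream_of X \<sigma>)" for X :: "nat set set"
  have str: "stream_of X (str X)" if "X \<subseteq> ?V2" for X
  proof -
    have "\<exists>\<sigma>. stream_of X \<sigma>"
      using finite_distinct_list [of X] that finV2 finite_subset by (auto simp: stream_of_def)
    then show ?thesis
      unfolding str_def by (rule someI_ex)
  qed
  have "finite H"
    using H finV2 finite_subset by blast
  have finT: "finite (T q)" if "q \<in> Qs" for q
    using T(1) \<open>finite H\<close> that by (metis UN_upper finite_subset)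
  let ?I = "Pow H \<times> Qs"
  have card_I: "card ?I = 2 ^ card H * card Qs"
    using \<open>finite H\<close> by (simp add: card_cartesian_product card_Pow)
  have card_H: "card H = card Qs * \<tau>"
    unfolding T(1) using T(2,3) Qs finT by (subst card_UN_disjoint') auto
  let ?good = "\<lambda>D (X, q). good (X \<union> bob q) (run D (str X @ str (bob q)))"
  \<comment> \<open>The algorithm is derandomized against a uniformly chosen pair of input and
    question.\<close>
  have "\<exists>D\<in>set_pmf A. 9/10 * real (card ?I) \<le> real (card {i \<in> ?I. ?good D i})"
  proof (rule pmf_ex_many)
    fix i assume "i \<in> ?I"
    then obtain X q where i: "i = (X, q)" "X \<subseteq> H" "q \<in> Qs"
      by auto
    then have "stream_of (X \<union> bob q) (str X @ str (bob q))" "X \<union> bob q \<subseteq> ?V2"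
      using str [of X] str [of "bob q"] bob [of q] H by (auto simp: stream_of_def)
    then show "9/10 \<le> measure_pmf.prob A {D. ?good D i}"
      using success i by simp
  qed (use \<open>finite H\<close> Qs in simp)
  then obtain D where D: "D \<in> set_pmf A"
    and many: "9/10 * real (card ?I) \<le> real (card {i \<in> ?I. ?good D i})"
    by blast
  define out where "out m q = dec q (result D (fold (update D) (str (bob q)) m))" for m q
  \<comment> \<open>Since the message does not depend on the question, all questions can be put to
    the same memory content; the answers are glued along the disjoint sets
    \<open>T q\<close>.\<close>
  define F where "F X = {e. \<exists>q\<in>Qs. e \<in> T q \<and> e \<in> out (memory D (str X)) q}" for X
  have F_T: "e \<in> F X \<longleftrightarrow> e \<in> out (memory D (str X)) q" if "q \<in> Qs" "e \<in> T q" for X q e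
  proof -
    have "q' = q" if "q' \<in> Qs" "e \<in> T q'" for q'
      using that \<open>q \<in> Qs\<close> \<open>e \<in> T q\<close> T(2) by (auto simp: disjoint_family_on_def)
    then show ?thesis
      unfolding F_def using that by blast
  qed
  \<comment> \<open>A question answered well costs at most a tenth of its bits; any other one may
    cost all \<open>\<tau>\<close> of them.\<close>
  have err: "real (card (sym_diff X (F X))) \<le>
      (\<Sum>q\<in>Qs. real \<tau> / 10 + real \<tau> * of_bool (\<not> ?good D (X, q)))" if X: "X \<subseteq> H" for X
  proof -
    let ?err = "\<lambda>q. {e \<in> T q. (e \<in> X) \<noteq> (e \<in> out (memory D (str X)) q)}"
    have "sym_diff X (F X) \<subseteq> (\<Union>q\<in>Qs. ?err q)"
    proof
      fix e assume e: "e \<in> sym_diff X (F X)"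
      then have "e \<in> H"
        using X T(1) by (auto simp: F_def)
      then obtain q where "q \<in> Qs" "e \<in> T q"
        using T(1) by blast
      then show "e \<in> (\<Union>q\<in>Qs. ?err q)"
        using e F_T [of q e X] by blast
    qed
    then have "card (sym_diff X (F X)) \<le> card (\<Union>q\<in>Qs. ?err q)"
      using Qs finT by (intro card_mono) auto
    also have "\<dots> \<le> (\<Sum>q\<in>Qs. card (?err q))"
      using Qs by (rule card_UN_le)
    finally have "real (card (sym_diff X (F X))) \<le> (\<Sum>q\<in>Qs. real (card (?err q)))"
      by (simp flip: of_nat_sum)
    also have "\<dots> \<le> (\<Sum>q\<in>Qs. real \<tau> / 10 + real \<tau> * of_bool (\<not> ?good D (X, q)))"
    proof (rule sum_mono)
      fix q assume q: "q \<in> Qs"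
      show "real (card (?err q)) \<le> real \<tau> / 10 + real \<tau> * of_bool (\<not> ?good D (X, q))"
      proof (cases "?good D (X, q)")
        case True
        then show ?thesis
          using decode [OF X q, of "run D (str X @ str (bob q))"]
          by (simp add: run_def memory_append out_def)
      next
        case False
        have "card (?err q) \<le> \<tau>"
          using T(3) [OF q] finT [OF q] by (metis (no_types, lifting) card_mono mem_Collect_eq subsetI)
        then show ?thesis
          using False by simp
      qed
    qed
    finally show ?thesis .
  qed
  have "(\<Sum>X\<in>Pow H. real (card (sym_diff X (F X)))) \<le>
      (\<Sum>X\<in>Pow H. \<Sum>q\<in>Qs. real \<tau> / 10 + real \<tau> * of_bool (\<not> ?good D (X, q)))"
    by (intro sum_mono err) auto
  also have "\<dots> = (\<Sum>i\<in>?I. real \<tau> / 10 + real \<tau> * of_bool (\<not> ?good D i))"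
    by (simp add: sum.cartesian_product case_prod_unfold)
  also have "\<dots> = real \<tau> / 10 * real (card ?I) + real \<tau> * real (card {i \<in> ?I. \<not> ?good D i})"
    using \<open>finite H\<close> Qs
    by (simp add: sum.distrib sum_distrib_left [symmetric] of_bool_def sum.If_cases Int_def
        Collect_neg_eq [symmetric] del: card_cartesian_product)
  also have "\<dots> \<le> real \<tau> / 10 * real (card ?I) + real \<tau> * (real (card ?I) / 10)"
  proof -
    have "card ({i \<in> ?I. ?good D i} \<union> {i \<in> ?I. \<not> ?good D i}) =
        card {i \<in> ?I. ?good D i} + card {i \<in> ?I. \<not> ?good D i}"
      using \<open>finite H\<close> Qs by (intro card_Un_disjoint) auto
    moreover have "{i \<in> ?I. ?good D i} \<union> {i \<in> ?I. \<not> ?good D i} = ?I"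
      by blast
    ultimately have "card ?I = card {i \<in> ?I. ?good D i} + card {i \<in> ?I. \<not> ?good D i}"
      by (simp only:)
    then have "real (card {i \<in> ?I. \<not> ?good D i}) \<le> real (card ?I) / 10"
      using many by linarith
    then show ?thesis
      by (intro add_left_mono mult_left_mono) simp_all
  qed
  \<comment> \<open>One tenth comes from errors in good answers and one tenth from the failing
    pairs, which makes \<open>card H / 5\<close>.\<close>
  also have "\<dots> = 2 ^ card H * (real (card H) / 5)"
    unfolding card_I card_H by (simp add: field_simps)
  finally have dist: "(\<Sum>X\<in>Pow H. real (card (sym_diff X (F X)))) \<le> 2 ^ card H * (real (card H) / 5)" .
  \<comment> \<open>\<open>F X\<close> depends on \<open>X\<close> only through the memory content
    after Alice's part of the stream.\<close>
  have "card (F ` Pow H) \<le> card {m :: bool list. length m \<le> s}"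
  proof (rule surj_card_le)
    show "finite {m :: bool list. length m \<le> s}"
      using finite_lists_length_le [of "UNIV :: bool set" s] by simp
    let ?G = "\<lambda>m. {e. \<exists>q\<in>Qs. e \<in> T q \<and> e \<in> out m q}"
    show "F ` Pow H \<subseteq> ?G ` {m. length m \<le> s}"
    proof clarify
      fix X assume "X \<subseteq> H"
      then have "X \<subseteq> ?V2"
        using H by blast
      then have "length (memory D (str X)) \<le> s"
        using space str D unfolding uses_space_def by blast
      then show "F X \<in> ?G ` {m. length m \<le> s}"
        by (auto simp: F_def)
    qed
  qed
  also have "\<dots> \<le> 2 ^ (s + 1)"
    by (rule card_bool_lists_length_le)
  finally show ?thesis
    using T(1) \<open>finite H\<close> dist by (intro card_le_bits_of_small_distortion [of H F]) (auto simp: F_def)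
qed

section \<open>The hard instances\<close>

text \<open>
  The vertices of the hard instances. The first argument is the group \<open>j\<close>, and \<open>LU j b\<close>,
  \<open>LV j b\<close> are the two sides of Alice's bipartite graph in block \<open>b\<close> of this group; the
  other vertices are isolated until Bob attaches them to the block that he asks about.
\<close>

datatype label = LU nat nat nat | LV nat nat nat | LW nat nat | LZ nat nat | LR nat nat | LY nat nat

fun group :: "label \<Rightarrow> nat" where
  "group (LU j _ _) = j"
| "group (LV j _ _) = j"
| "group (LW j _) = j"
| "group (LZ j _) = j"
| "group (LR j _) = j"
| "group (LY j _) = j"

fun valid :: "nat \<Rightarrow> nat \<Rightarrow> nat \<Rightarrow> nat \<Rightarrow> label \<Rightarrow> bool" where
  "valid K B t z (LU j b i) \<longleftrightarrow> j < K \<and> b < B \<and> i < t"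
| "valid K B t z (LV j b i) \<longleftrightarrow> j < K \<and> b < B \<and> i < t"
| "valid K B t z (LW j i) \<longleftrightarrow> j < K \<and> i < z"
| "valid K B t z (LZ j i) \<longleftrightarrow> j < K \<and> i < z"
| "valid K B t z (LR j i) \<longleftrightarrow> j < K \<and> i < t"
| "valid K B t z (LY j i) \<longleftrightarrow> j < K \<and> i < t"

lemma card_valid_le:
  "finite {x. valid K B t z x} \<and> card {x. valid K B t z x} \<le> K * (2 * (B * t) + 2 * z + 2 * t)"
proof -
  let ?I = "{..<K} \<times> {..<B} \<times> {..<t}" and ?Jz = "{..<K} \<times> {..<z}" and ?Jt = "{..<K} \<times> {..<t}"
  let ?L = "((\<lambda>(j, b, i). LU j b i) ` ?I \<union> (\<lambda>(j, b, i). LV j b i) ` ?I) \<union>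
    (((\<lambda>(j, i). LW j i) ` ?Jz \<union> (\<lambda>(j, i). LZ j i) ` ?Jz) \<union>
    ((\<lambda>(j, i). LR j i) ` ?Jt \<union> (\<lambda>(j, i). LY j i) ` ?Jt))"
  have "x \<in> ?L" if "valid K B t z x" for x
    using that by (cases x) (auto simp: image_iff)
  then have sub: "{x. valid K B t z x} \<subseteq> ?L"
    by blast
  have fin: "finite ?L"
    by simp
  have "card ?L \<le> (card ?I + card ?I) + ((card ?Jz + card ?Jz) + (card ?Jt + card ?Jt))"
    by (intro order.trans [OF card_Un_le] add_mono card_image_le) auto
  also have "\<dots> = K * (2 * (B * t) + 2 * z + 2 * t)"
    by (simp add: algebra_simps)
  finally show ?thesis
    using sub fin by (meson card_mono finite_subset le_trans)
qed

text \<open>For \<open>q = (b, p)\<close>, the dense graphs are \<open>LY\<close> and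
  \<open>u\<close> against \<open>LW\<close>, and \<open>LR\<close> and the other left vertices of
  block \<open>b\<close> against \<open>LZ\<close>. The edges from \<open>LR\<close> to the right
  side tie the latter to the second dense graph. The relation is oriented; \<open>bob\<close>
  forgets the direction.\<close>

fun bob_adj :: "nat \<times> nat \<Rightarrow> label \<Rightarrow> label \<Rightarrow> bool" where
  "bob_adj q (LY j _) (LW j' _) \<longleftrightarrow> j = j'"
| "bob_adj q (LU j b i) (LW j' _) \<longleftrightarrow> j = j' \<and> (b, i) = q"
| "bob_adj q (LU j b i) (LZ j' _) \<longleftrightarrow> j = j' \<and> b = fst q \<and> i \<noteq> snd q"
| "bob_adj q (LR j _) (LZ j' _) \<longleftrightarrow> j = j'"
| "bob_adj q (LR j _) (LV j' b _) \<longleftrightarrow> j = j' \<and> b = fst q"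
| "bob_adj _ _ _ \<longleftrightarrow> False"

text \<open>\<open>f\<close> numbers the labels by stream vertices; the left inverse
  \<open>lab\<close> makes it injective on valid labels and recovers the group of a vertex.\<close>

locale hard_instance =
  fixes K B t z n :: nat and f :: "label \<Rightarrow> nat" and lab :: "nat \<Rightarrow> label"
  assumes f_less: "valid K B t z x \<Longrightarrow> f x < n"
    and lab_f: "valid K B t z x \<Longrightarrow> lab (f x) = x"
begin

abbreviation ok :: "label \<Rightarrow> bool" where
  "ok \<equiv> valid K B t z"

lemma f_eq_iff: "ok x \<Longrightarrow> ok y \<Longrightarrow> f x = f y \<longleftrightarrow> x = y"
  by (metis lab_f)

lemma card_f_image:
  assumes "inj_on h I" "\<And>i. i \<in> I \<Longrightarrow> ok (h i)"
  shows "card ((\<lambda>i. f (h i)) ` I) = card I"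
proof (rule card_image)
  show "inj_on (\<lambda>i. f (h i)) I"
    using assms by (auto simp: inj_on_def f_eq_iff)
qed

section \<open>Alice's bits and Bob's edges\<close>

definition slot :: "nat \<Rightarrow> nat \<Rightarrow> nat \<Rightarrow> nat \<Rightarrow> nat set" where
  "slot j b p i = {f (LU j b p), f (LV j b i)}"

text \<open>The bits that one question reads: the possible edges at the left vertex
  \<open>snd q\<close> of block \<open>fst q\<close>, in all groups at once.\<close>

definition asked :: "nat \<times> nat \<Rightarrow> nat set set" where
  "asked q = (\<lambda>(j, i). slot j (fst q) (snd q) i) ` ({..<K} \<times> {..<t})"

definition slots :: "nat set set" where
  "slots = (\<Union>q\<in>{..<B} \<times> {..<t}. asked q)"

definition bob :: "nat \<times> nat \<Rightarrow> nat set set" where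
  "bob q = {{f x, f y} | x y. ok x \<and> ok y \<and> bob_adj q x y}"

lemma slot_eq_iff:
  assumes "j < K" "b < B" "p < t" "i < t" "j' < K" "b' < B" "p' < t" "i' < t"
  shows "slot j b p i = slot j' b' p' i' \<longleftrightarrow> j = j' \<and> b = b' \<and> p = p' \<and> i = i'"
  using assms by (auto simp: slot_def doubleton_eq_iff f_eq_iff)

lemma finite_asked: "finite (asked q)"
  by (simp add: asked_def)

lemma card_asked: "q \<in> {..<B} \<times> {..<t} \<Longrightarrow> card (asked q) = K * t"
  unfolding asked_def by (subst card_image) (auto simp: inj_on_def slot_eq_iff)

lemma disjoint_asked: "disjoint_family_on asked ({..<B} \<times> {..<t})"
  by (auto simp: disjoint_family_on_def asked_def slot_eq_iff)

lemma card_slots: "card slots = B * t * (K * t)"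
proof -
  have "card slots = (\<Sum>q\<in>{..<B} \<times> {..<t}. card (asked q))"
    unfolding slots_def by (intro card_UN_disjoint' disjoint_asked finite_asked) simp
  also have "\<dots> = (\<Sum>q\<in>{..<B} \<times> {..<t}. K * t)"
    by (intro sum.cong refl card_asked)
  finally show ?thesis
    by (simp add: card_cartesian_product)
qed

lemma slots_iff: "e \<in> slots \<longleftrightarrow> (\<exists>j b p i. e = slot j b p i \<and> j < K \<and> b < B \<and> p < t \<and> i < t)"
  by (auto simp: slots_def asked_def)

lemma not_bob_adj_self: "\<not> bob_adj q x x"
  by (cases x) auto

lemma slots_nsets: "slots \<subseteq> [{..<n}]\<^bsup>2\<^esup>"
  by (auto simp: slots_iff slot_def f_eq_iff f_less)

lemma bob_nsets: "bob q \<subseteq> [{..<n}]\<^bsup>2\<^esup>"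
  using not_bob_adj_self [of q] by (auto simp: bob_def f_eq_iff f_less)

text \<open>\<open>bob_adj\<close> never relates a left to a right vertex. Hence Bob's edges can be
  appended to the stream without repeating an edge.\<close>

lemma bob_disjoint_slots: "bob q \<inter> slots = {}"
proof -
  have False if "ok x" "ok y" "bob_adj q x y" "{f x, f y} = slot j b p i"
    "j < K" "b < B" "p < t" "i < t" for x y j b p i
  proof -
    have "x = LU j b p \<and> y = LV j b i \<or> x = LV j b i \<and> y = LU j b p"
      using that by (auto simp: slot_def doubleton_eq_iff f_eq_iff)
    then show False
      using \<open>bob_adj q x y\<close> by auto
  qed
  then show ?thesis
    unfolding bob_def slots_iff disjoint_iff mem_Collect_eq by metis
qed

lemma bob_cases:
  assumes "e \<in> bob (b, p)"
  obtains j i w where "e = {f (LY j i), f (LW j w)}" "j < K" "i < t" "w < z"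
  | j w where "e = {f (LU j b p), f (LW j w)}" "j < K" "w < z" "b < B" "p < t"
  | j i w where "e = {f (LU j b i), f (LZ j w)}" "j < K" "w < z" "b < B" "i < t" "i \<noteq> p"
  | j i w where "e = {f (LR j i), f (LZ j w)}" "j < K" "i < t" "w < z"
  | j i i' where "e = {f (LR j i), f (LV j b i')}" "j < K" "i < t" "i' < t" "b < B"
proof -
  obtain x y where "e = {f x, f y}" "ok x" "ok y" "bob_adj (b, p) x y"
    using assms by (auto simp: bob_def)
  then show ?thesis
    using that by (cases x; cases y) auto
qed

text \<open>In the second image, the endpoint \<open>LU j b i\<close> determines the type of the other one.\<close>

lemma card_bob_le:
  assumes "p < t"
  shows "card (bob (b, p)) \<le> 3 * (K * t * z) + K * t * t"
proof -
  let ?I = "{..<K} \<times> {..<t} \<times> {..<z}" and ?J = "{..<K} \<times> {..<t} \<times> {..<t}"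
  let ?L1 = "(\<lambda>(j, i, w). {f (LY j i), f (LW j w)}) ` ?I"
  let ?L2 = "(\<lambda>(j, i, w). {f (LU j b i), f (if i = p then LW j w else LZ j w)}) ` ?I"
  let ?L3 = "(\<lambda>(j, i, w). {f (LR j i), f (LZ j w)}) ` ?I"
  let ?L4 = "(\<lambda>(j, i, i'). {f (LR j i), f (LV j b i')}) ` ?J"
  have "bob (b, p) \<subseteq> (?L1 \<union> ?L2) \<union> (?L3 \<union> ?L4)"
  proof
    fix e assume "e \<in> bob (b, p)"
    then show "e \<in> (?L1 \<union> ?L2) \<union> (?L3 \<union> ?L4)"
    proof (cases rule: bob_cases)
      case (1 j i w)
      then have "e \<in> ?L1"
        by (intro image_eqI [of _ _ "(j, i, w)"]) auto
      then show ?thesis by blast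
    next
      case (2 j w)
      then have "e \<in> ?L2"
        by (intro image_eqI [of _ _ "(j, p, w)"]) auto
      then show ?thesis by blast
    next
      case (3 j i w)
      then have "e \<in> ?L2"
        by (intro image_eqI [of _ _ "(j, i, w)"]) auto
      then show ?thesis by blast
    next
      case (4 j i w)
      then have "e \<in> ?L3"
        by (intro image_eqI [of _ _ "(j, i, w)"]) auto
      then show ?thesis by blast
    next
      case (5 j i i')
      then have "e \<in> ?L4"
        by (intro image_eqI [of _ _ "(j, i, i')"]) auto
      then show ?thesis by blast
    qed
  qed
  then have "card (bob (b, p)) \<le> card ((?L1 \<union> ?L2) \<union> (?L3 \<union> ?L4))"
    by (intro card_mono) auto
  also have "\<dots> \<le> (card ?I + card ?I) + (card ?I + card ?J)"
    by (intro order.trans [OF card_Un_le] add_mono card_image_le) auto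
  also have "\<dots> = 3 * (K * t * z) + K * t * t"
    by (simp add: algebra_simps)
  finally show ?thesis .
qed

text \<open>An upper bound for the adjacency that does not depend on \<open>X\<close>: every slot
  counts as present. It serves to exclude edges.\<close>

definition adj :: "nat \<times> nat \<Rightarrow> label \<Rightarrow> label \<Rightarrow> bool" where
  "adj q x y \<longleftrightarrow> bob_adj q x y \<or> (\<exists>j b p i. x = LU j b p \<and> y = LV j b i)"

lemma edge_labels:
  assumes "X \<subseteq> slots" "{a, a'} \<in> X \<union> bob q"
  obtains x y where "a = f x" "a' = f y" "ok x" "ok y" "adj q x y \<or> adj q y x"
proof -
  obtain x y where xy: "{a, a'} = {f x, f y}" "ok x" "ok y" "adj q x y"
  proof (cases "{a, a'} \<in> X")
    case True
    then have "{a, a'} \<in> slots"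
      using assms by blast
    then obtain j b p i where "{a, a'} = slot j b p i" "j < K" "b < B" "p < t" "i < t"
      unfolding slots_iff by blast
    then show ?thesis
      by (intro that [of "LU j b p" "LV j b i"]) (simp_all add: adj_def slot_def)
  next
    case False
    then have "{a, a'} \<in> bob q"
      using assms by blast
    then show ?thesis
      using that by (auto simp: bob_def adj_def)
  qed
  then consider "a = f x" "a' = f y" | "a = f y" "a' = f x"
    by (metis doubleton_eq_iff)
  then show ?thesis
    using that xy(2-4) by cases blast+
qed

section \<open>Decoding within one group\<close>

definition group_edges :: "nat \<Rightarrow> nat set set \<Rightarrow> nat set set" where
  "group_edges j E = {e \<in> E. \<forall>a\<in>e. group (lab a) = j}"

lemma bob_group_edges:
  assumes "ok x" "ok y" "bob_adj q x y" "group x = j" "group y = j"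
  shows "{f x, f y} \<in> group_edges j (X \<union> bob q)"
  using assms by (auto simp: group_edges_def bob_def lab_f)

text \<open>The set \<open>I\<close> consists of the right vertices outside the cluster
  \<open>Q\<close> of the second dense part. All neighbours of any other right vertex except
  \<open>u\<close> lie in \<open>Q\<close>, so only its edge to \<open>u\<close> can survive level
  1.\<close>

lemma group_decoding:
  fixes \<phi> :: real
  assumes X: "X \<subseteq> slots" and q: "b < B" "p < t" and j: "j < K"
    and part: "partition_on {..<n} \<U>"
    and expd: "\<forall>Q\<in>\<U>. expander \<phi> Q (induced_edges (X \<union> bob (b, p)) Q)"
    and t: "t \<ge> 2" and \<phi>: "\<phi> * real z > 2"
    and few: "card {e \<in> group_edges j (X \<union> bob (b, p)). \<forall>Q\<in>\<U>. \<not> e \<subseteq> Q} < z"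
  shows "\<exists>I\<subseteq>{..<t}. t * card I \<le> card {e \<in> group_edges j (X \<union> bob (b, p)). \<forall>Q\<in>\<U>. \<not> e \<subseteq> Q} \<and>
    (\<forall>i\<in>{..<t} - I. (\<forall>Q\<in>\<U>. \<not> slot j b p i \<subseteq> Q) \<and>
      (\<forall>e\<in>X \<union> bob (b, p). f (LV j b i) \<in> e \<longrightarrow> (\<forall>Q\<in>\<U>. \<not> e \<subseteq> Q) \<longrightarrow> e = slot j b p i \<and> e \<in> X))"
proof -
  let ?E = "X \<union> bob (b, p)" and ?u = "f (LU j b p)"
  let ?d = "card {e \<in> group_edges j ?E. \<forall>Q\<in>\<U>. \<not> e \<subseteq> Q}"
  define Y where "Y = (\<lambda>i. f (LY j i)) ` {..<t}"
  define W where "W = (\<lambda>i. f (LW j i)) ` {..<z}"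
  define R where "R = (\<lambda>i. f (LR j i)) ` {..<t}"
  define Z where "Z = (\<lambda>i. f (LZ j i)) ` {..<z}"
  define C where "C = (\<lambda>i. f (LV j b i)) ` {..<t}"
  define U where "U = (\<lambda>i. f (LU j b i)) ` ({..<t} - {p})"
  note defs = Y_def W_def R_def Z_def C_def U_def
  have cards: "card Y = t" "card W = z" "card R = t" "card Z = z" "card C = t"
    unfolding defs by (subst card_f_image; use q j in \<open>auto simp: inj_on_def\<close>)+
  have E_nsets: "?E \<subseteq> [{..<n}]\<^bsup>2\<^esup>"
    using X slots_nsets bob_nsets by blast
  then have finE: "finite ?E"
    using finite_imp_finite_nsets finite_subset by blast
  \<comment> \<open>The sparse cut separates \<open>u\<close>, \<open>Y\<close> and \<open>W\<close>
    from the rest; \<open>C\<close> is the right side of the block.\<close>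
  have "\<exists>Q\<in>\<U>. R \<union> U \<subseteq> Q \<and> ?u \<notin> Q \<and> t * card (C - Q) \<le> ?d"
  proof (rule sparse_cut_is_separated [OF part bspec [OF expd], where A = "insert ?u Y" and W = W and Z = Z and z = z])
    show "group_edges j ?E \<subseteq> ?E"
      by (auto simp: group_edges_def)
    show "insert ?u Y \<subseteq> {..<n}" "W \<subseteq> {..<n}" "R \<union> U \<subseteq> {..<n}" "Z \<subseteq> {..<n}" "C \<subseteq> {..<n}"
      using q j by (auto simp: defs f_less)
    show "insert ?u Y \<inter> W = {}" "(insert ?u Y \<union> W) \<inter> (R \<union> U \<union> Z) = {}" "(R \<union> U) \<inter> Z = {}"
      "C \<inter> R = {}"
      using q j by (auto simp: defs f_eq_iff)
    show "{a, w} \<in> group_edges j ?E" if "a \<in> insert ?u Y" "w \<in> W" for a w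
      using that q j by (auto simp: defs intro!: bob_group_edges)
    show "{a, w} \<in> group_edges j ?E" if "a \<in> R \<union> U" "w \<in> Z" for a w
      using that q j by (auto simp: defs intro!: bob_group_edges)
    show "{a, w} \<in> group_edges j ?E" if "a \<in> R" "w \<in> C" for a w
      using that q j by (auto simp: defs intro!: bob_group_edges)
    \<comment> \<open>Vertices of \<open>Y\<close> and \<open>W\<close> have neighbours only on
      their own side of the cut, and \<open>u\<close> has further ones only in
      \<open>C\<close>.\<close>
    show "a = ?u \<and> a' \<in> C"
      if a: "a \<in> insert ?u Y \<union> W" and a': "a' \<notin> insert ?u Y \<union> W" and "{a, a'} \<in> ?E" for a a'
    proof -
      obtain x y where xy: "a = f x" "a' = f y" "ok x" "ok y" "adj (b, p) x y \<or> adj (b, p) y x"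
        using edge_labels [OF X \<open>{a, a'} \<in> ?E\<close>] .
      consider "x = LU j b p" | i where "x = LY j i" | w where "x = LW j w"
        using a q j \<open>ok x\<close> unfolding \<open>a = f x\<close> by (auto simp: defs f_eq_iff)
      then show ?thesis
        by cases (use xy a' in \<open>cases y; auto simp: defs adj_def\<close>)+
    qed
    show "t \<le> card (insert ?u Y)"
      using cards card_insert_le [of Y ?u] by simp
  qed (use finE cards t \<phi> few in simp_all)
  then obtain Q where Q: "Q \<in> \<U>" "R \<union> U \<subseteq> Q" "?u \<notin> Q" "t * card (C - Q) \<le> ?d"
    by blast
  define I where "I = {i \<in> {..<t}. f (LV j b i) \<notin> Q}"
  have "C - Q = (\<lambda>i. f (LV j b i)) ` I"
    by (auto simp: C_def I_def)
  then have "card I = card (C - Q)"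
    using q j card_f_image [of "\<lambda>i. LV j b i" I] by (simp add: inj_on_def I_def)
  moreover have "\<forall>Q\<in>\<U>. \<not> slot j b p i \<subseteq> Q" if "i \<in> {..<t} - I" for i
  proof -
    have "f (LV j b i) \<in> Q"
      using that by (simp add: I_def)
    then show ?thesis
      using partition_onD2 [OF part] Q by (auto simp: slot_def dest: disjointD)
  qed
  moreover have "e = slot j b p i \<and> e \<in> X"
    if "i \<in> {..<t} - I" "e \<in> ?E" "f (LV j b i) \<in> e" and sep: "\<forall>Q\<in>\<U>. \<not> e \<subseteq> Q" for i e
  proof -
    have V: "f (LV j b i) \<in> Q" "i < t"
      using that by (auto simp: I_def)
    have RU: "f (LR j i') \<in> Q" "i' \<noteq> p \<Longrightarrow> f (LU j b i') \<in> Q" if "i' < t" for i'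
      using Q that by (auto simp: R_def U_def)
    obtain a where e: "e = {f (LV j b i), a}"
      using E_nsets \<open>e \<in> ?E\<close> \<open>f (LV j b i) \<in> e\<close> by (force simp: nsets_2_eq)
    then have "a \<notin> Q"
      using sep Q(1) V by auto
    obtain x y where xy: "f (LV j b i) = f x" "a = f y" "ok x" "ok y" "adj (b, p) x y \<or> adj (b, p) y x"
      using edge_labels [OF X, of "f (LV j b i)" a "(b, p)"] \<open>e \<in> ?E\<close> e by blast
    then have "x = LV j b i"
      using V q j f_eq_iff [of "LV j b i" x] by simp
    then have "y = LU j b p"
      using xy(3-5) RU \<open>a \<notin> Q\<close> \<open>a = f y\<close> by (cases y) (auto simp: adj_def)
    then have "e = slot j b p i"
      using e \<open>a = f y\<close> by (auto simp: slot_def)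
    \<comment> \<open>A slot that is present in the graph must come from \<open>X\<close>, as Bob's
      edges are not slots.\<close>
    moreover have "slot j b p i \<in> slots"
      using V q j slots_iff by blast
    ultimately show ?thesis
      using \<open>e \<in> ?E\<close> bob_disjoint_slots by blast
  qed
  ultimately show ?thesis
    using Q by (intro exI [of _ I]) (auto simp: I_def)
qed

section \<open>Counting the wrong bits over all groups\<close>

lemma card_UN_bad_le:
  fixes d :: "nat \<Rightarrow> nat"
  assumes "\<And>j. j < K \<Longrightarrow> finite (I j)" "\<And>j. j < K \<Longrightarrow> real (card (I j)) \<le> c * real (d j)"
  shows "real (card (\<Union>j<K. slot j b p ` I j)) \<le> c * real (\<Sum>j<K. d j)"
proof -
  have "card (\<Union>j<K. slot j b p ` I j) \<le> (\<Sum>j<K. card (slot j b p ` I j))"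
    by (rule card_UN_le) simp
  also have "\<dots> \<le> (\<Sum>j<K. card (I j))"
    using assms(1) by (intro sum_mono card_image_le) auto
  finally have "real (card (\<Union>j<K. slot j b p ` I j)) \<le> (\<Sum>j<K. real (card (I j)))"
    by (simp flip: of_nat_sum)
  also have "\<dots> \<le> (\<Sum>j<K. c * real (d j))"
    using assms(2) by (intro sum_mono) simp
  finally show ?thesis
    by (simp add: sum_distrib_left)
qed

text \<open>A nonempty edge belongs to at most one group, whereas \<open>{}\<close> would belong to
  every group.\<close>

lemma sum_card_group_edges_le:
  assumes "finite D" "{} \<notin> D"
  shows "(\<Sum>j<K. card (group_edges j D)) \<le> card D"
proof -
  have "(\<Sum>j<K. card (group_edges j D)) = card (\<Union>j<K. group_edges j D)"
  proof (rule card_UN_disjoint' [symmetric])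
    have "j = j'" if "e \<in> group_edges j D" "e \<in> group_edges j' D" for e j j'
    proof -
      have "e \<noteq> {}"
        using that \<open>{} \<notin> D\<close> by (auto simp: group_edges_def)
      then obtain a where "a \<in> e"
        by blast
      then show ?thesis
        using that by (auto simp: group_edges_def)
    qed
    then show "disjoint_family_on (\<lambda>j. group_edges j D) {..<K}"
      by (fastforce simp: disjoint_family_on_def)
  qed (use \<open>finite D\<close> in \<open>auto simp: group_edges_def\<close>)
  also have "\<dots> \<le> card D"
    using \<open>finite D\<close> by (intro card_mono) (auto simp: group_edges_def)
  finally show ?thesis .
qed

text \<open>
  A group with at least \<open>z\<close> edges removed at level 1 is given up, which costs \<open>t\<close> slots; in any
  other group, each lost slot is paid for by \<open>t\<close> removed edges.
\<close>

lemma card_wrong_slots_le: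
  assumes X: "X \<subseteq> slots" and q: "b < B" "p < t" and t: "t \<ge> 2" and "\<phi> > 0" and \<phi>: "\<phi> * real z > 2"
    and part1: "partition_on {..<n} \<U>"
    and exp1: "\<forall>Q\<in>\<U>. expander \<phi> Q (induced_edges (X \<union> bob (b, p)) Q)"
    and E2: "E2 = inter_cluster_edges (X \<union> bob (b, p)) \<U>"
    and exp2: "\<And>Q. Q \<in> \<U>' \<Longrightarrow> expander \<phi> Q (induced_edges E2 Q)"
  shows "real (card {e \<in> asked (b, p). (e \<in> X) \<noteq> (\<exists>Q\<in>\<U>'. e \<subseteq> Q)}) \<le>
    (real t / real z + 1 / real t) * real (card E2) + real (card (inter_cluster_edges E2 \<U>'))"
proof -
  let ?E = "X \<union> bob (b, p)" and ?err = "{e \<in> asked (b, p). (e \<in> X) \<noteq> (\<exists>Q\<in>\<U>'. e \<subseteq> Q)}"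
  let ?E3 = "inter_cluster_edges E2 \<U>'" and ?c = "real t / real z + 1 / real t"
  have E_nsets: "?E \<subseteq> [{..<n}]\<^bsup>2\<^esup>"
    using X slots_nsets bob_nsets by blast
  have E2_iff: "e \<in> E2 \<longleftrightarrow> e \<in> ?E \<and> (\<forall>Q\<in>\<U>. \<not> e \<subseteq> Q)" for e
    unfolding E2 using E_nsets by (intro inter_cluster_edges_iff) blast
  then have E2_nsets: "E2 \<subseteq> [{..<n}]\<^bsup>2\<^esup>"
    using E_nsets by blast
  have E3_iff: "e \<in> ?E3 \<longleftrightarrow> e \<in> E2 \<and> (\<forall>Q\<in>\<U>'. \<not> e \<subseteq> Q)" for e
    using E2_nsets by (intro inter_cluster_edges_iff) blast
  have finE2: "finite E2"
    using E2_nsets finite_imp_finite_nsets finite_subset by blast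
  then have finE3: "finite ?E3"
    by (simp add: inter_cluster_edges_def)
  have d: "{e \<in> group_edges j ?E. \<forall>Q\<in>\<U>. \<not> e \<subseteq> Q} = group_edges j E2" for j
    by (rule set_eqI) (simp only: group_edges_def E2_iff mem_Collect_eq conj_ac)
  \<comment> \<open>\<open>I\<close> holds the slots given up in group \<open>j\<close>, charged to
    the edges of \<open>E2\<close> in this group. The rate \<open>?c\<close> adds the rate
    \<open>t / z\<close> of an abandoned group and the rate \<open>1 / t\<close> of any
    other.\<close>
  define lost where "lost j I \<longleftrightarrow> I \<subseteq> {..<t} \<and> real (card I) \<le> ?c * real (card (group_edges j E2)) \<and>
      (\<forall>i\<in>{..<t} - I. (\<forall>Q\<in>\<U>. \<not> slot j b p i \<subseteq> Q) \<and>
        (\<forall>e\<in>E2. f (LV j b i) \<in> e \<longrightarrow> e = slot j b p i \<and> e \<in> X))" for j I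
  have "\<exists>I. lost j I" if j: "j < K" for j
  proof (cases "card (group_edges j E2) < z")
    case True
    then obtain I where "I \<subseteq> {..<t}" "t * card I \<le> card (group_edges j E2)"
      and I: "\<forall>i\<in>{..<t} - I. (\<forall>Q\<in>\<U>. \<not> slot j b p i \<subseteq> Q) \<and>
        (\<forall>e\<in>?E. f (LV j b i) \<in> e \<longrightarrow> (\<forall>Q\<in>\<U>. \<not> e \<subseteq> Q) \<longrightarrow> e = slot j b p i \<and> e \<in> X)"
      using group_decoding [OF X q j part1 exp1 t \<phi>, unfolded d, OF True] by (elim exE conjE) (rule that)
    then have "real t * real (card I) \<le> real (card (group_edges j E2))"
      by (simp flip: of_nat_mult)
    then have "real (card I) \<le> 1 / real t * real (card (group_edges j E2))"
      using t by (simp add: field_simps)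
    also have "\<dots> \<le> ?c * real (card (group_edges j E2))"
      by (intro mult_right_mono) auto
    finally show ?thesis
      using I \<open>I \<subseteq> {..<t}\<close> by (intro exI [of _ I]) (simp add: lost_def E2_iff)
  next
    case False
    have "z > 0"
      using \<phi> by (cases z) auto
    have "real (card {..<t}) = real t / real z * real z"
      using \<open>z > 0\<close> by simp
    also have "\<dots> \<le> real t / real z * real (card (group_edges j E2))"
      using False by (intro mult_left_mono) auto
    also have "\<dots> \<le> ?c * real (card (group_edges j E2))"
      by (intro mult_right_mono) auto
    finally show ?thesis
      by (intro exI [of _ "{..<t}"]) (simp add: lost_def)
  qed
  then obtain I where lost: "\<And>j. j < K \<Longrightarrow> lost j (I j)"
    by metis
  have I: "I j \<subseteq> {..<t}" and card_I: "real (card (I j)) \<le> ?c * real (card (group_edges j E2))"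
    and kept: "\<forall>i\<in>{..<t} - I j. (\<forall>Q\<in>\<U>. \<not> slot j b p i \<subseteq> Q) \<and>
      (\<forall>e\<in>E2. f (LV j b i) \<in> e \<longrightarrow> e = slot j b p i \<and> e \<in> X)" if "j < K" for j
    using lost [OF that] unfolding lost_def by - (elim conjE, assumption)+
  have finI: "finite (I j)" if "j < K" for j
    using I [OF that] finite_subset by blast
  note cut = bspec [OF kept, THEN conjunct1, THEN bspec]
    and pendant = bspec [OF kept, THEN conjunct2, THEN bspec, THEN mp]
  \<comment> \<open>A slot of \<open>X\<close> that is not lost survives level 1, so an error means
    that it is cut at level 2. For a slot outside \<open>X\<close> that is not lost, the right
    vertex is isolated in \<open>E2\<close>, so its cluster is a singleton and no error
    occurs.\<close>
  have "?err \<subseteq> (\<Union>j<K. slot j b p ` I j) \<union> ?E3"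
  proof
    fix e assume e: "e \<in> ?err"
    then obtain j i where ji: "e = slot j b p i" "j < K" "i < t"
      by (auto simp: asked_def)
    show "e \<in> (\<Union>j<K. slot j b p ` I j) \<union> ?E3"
    proof (cases "i \<in> I j")
      case True
      then show ?thesis
        using ji by blast
    next
      case False
      then have i: "i \<in> {..<t} - I j"
        using ji by blast
      show ?thesis
      proof (cases "e \<in> X")
        case True
        then have "e \<in> E2"
          using cut [OF \<open>j < K\<close> i] ji(1) E2_iff by blast
        then show ?thesis
          using e True E3_iff by blast
      next
        case False
        then obtain Q where Q: "Q \<in> \<U>'" "e \<subseteq> Q"
          using e by blast
        have "f (LV j b i) \<notin> e'" if "e' \<in> induced_edges E2 Q" for e'
          using that pendant [OF \<open>j < K\<close> i] False ji(1) by (auto simp: induced_edges_def)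
        then have "Q = {f (LV j b i)}"
          using Q ji(1) by (intro expander_isolated_vertex [OF exp2 [OF Q(1)] \<open>\<phi> > 0\<close>])
            (auto simp: slot_def)
        then show ?thesis
          using Q ji q by (auto simp: slot_def f_eq_iff)
      qed
    qed
  qed
  then have "card ?err \<le> card ((\<Union>j<K. slot j b p ` I j) \<union> ?E3)"
    using finE3 finI by (intro card_mono) auto
  also have "\<dots> \<le> card (\<Union>j<K. slot j b p ` I j) + card ?E3"
    by (rule card_Un_le)
  finally have "real (card ?err) \<le> real (card (\<Union>j<K. slot j b p ` I j)) + real (card ?E3)"
    by (simp flip: of_nat_add)
  moreover have "real (card (\<Union>j<K. slot j b p ` I j)) \<le> ?c * real (\<Sum>j<K. card (group_edges j E2))"
    by (rule card_UN_bad_le [OF finI card_I])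
  moreover have "?c * real (\<Sum>j<K. card (group_edges j E2)) \<le> ?c * real (card E2)"
  proof (rule mult_left_mono)
    have "{} \<notin> E2"
      using E2_nsets by (auto simp: nsets_def)
    then show "real (\<Sum>j<K. card (group_edges j E2)) \<le> real (card E2)"
      using sum_card_group_edges_le finE2 by (simp only: of_nat_le_iff)
  qed simp
  ultimately show ?thesis
    by linarith
qed

lemma card_edges_le:
  assumes "X \<subseteq> slots" "B * t \<le> z" "t \<le> z" "p < t"
  shows "card (X \<union> bob (b, p)) \<le> 5 * (K * t * z)"
proof -
  have "finite slots"
    by (simp add: slots_def finite_asked)
  have "card (X \<union> bob (b, p)) \<le> card X + card (bob (b, p))"
    by (rule card_Un_le)
  also have "\<dots> \<le> card slots + (3 * (K * t * z) + K * t * t)"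
    using assms card_bob_le \<open>finite slots\<close> by (intro add_mono card_mono) auto
  also have "\<dots> \<le> K * t * z + (3 * (K * t * z) + K * t * z)"
  proof (intro add_mono order_refl)
    have "card slots = K * t * (B * t)"
      by (simp add: card_slots mult_ac)
    then show "card slots \<le> K * t * z"
      using assms by simp
  qed (use assms in simp)
  finally show ?thesis
    by simp
qed

text \<open>The decoder reads \<open>Us ! 1\<close>, the partition of level 2. At most
  \<open>M\<close> edges survive level 1 and at most \<open>M / t\<close> survive level 2, so the
  errors number at most \<open>(t / z + 2 / t) * M\<close>.\<close>

lemma removal_ED_sequence_decoding:
  assumes X: "X \<subseteq> slots" and q: "q \<in> {..<B} \<times> {..<t}"
    and par: "2 \<le> t" "t \<le> z" "B * t \<le> z" "z \<le> t\<^sup>2" "0 < \<phi>" "2 < \<phi> * real z"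
    and \<epsilon>: "0 < \<epsilon>" "\<epsilon> * real t \<le> 1/200" and "2 \<le> l"
    and seq: "removal_ED_sequence l \<epsilon> \<phi> {..<n} (X \<union> bob q) Us"
  shows "10 * card {e \<in> asked q. (e \<in> X) \<noteq> (e \<in> {e. \<exists>Q\<in>Us ! 1. e \<subseteq> Q})} \<le> K * t"
proof -
  obtain b p where [simp]: "q = (b, p)" and bp: "b < B" "p < t"
    using q by auto
  let ?E = "X \<union> bob (b, p)" and ?c = "real t / real z + 1 / real t"
  define E2 where "E2 = inter_cluster_edges ?E (Us ! 0)"
  let ?E3 = "inter_cluster_edges E2 (Us ! 1)"
  have "expander_decomposition \<epsilon> \<phi> {..<n} (level_edges (X \<union> bob q) Us i) (Us ! i)" if "i < l" for i
    using seq that by (simp add: removal_ED_sequence_def)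
  from this [of 0] this [of 1] have ED: "expander_decomposition \<epsilon> \<phi> {..<n} ?E (Us ! 0)"
    "expander_decomposition \<epsilon> \<phi> {..<n} E2 (Us ! 1)"
    using \<open>2 \<le> l\<close> by (auto simp: E2_def)
  have E_nsets: "?E \<subseteq> [{..<n}]\<^bsup>2\<^esup>"
    using X slots_nsets bob_nsets by blast
  then have E2_nsets: "E2 \<subseteq> [{..<n}]\<^bsup>2\<^esup>"
    by (auto simp: E2_def inter_cluster_edges_def)
  define M where "M = real K * real z / 40"
  have "M \<ge> 0"
    by (simp add: M_def)
  have "real (card E2) \<le> \<epsilon> * real (card ?E)"
    unfolding E2_def using ED E_nsets by (intro expander_decomposition_card_inter_cluster_edges) auto
  also have "\<dots> \<le> \<epsilon> * real (5 * (K * t * z))"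
    using card_edges_le [OF X] par bp \<epsilon> by (intro mult_left_mono) (simp_all only: of_nat_le_iff)
  also have "\<dots> = (\<epsilon> * real t) * (5 * (real K * real z))"
    by simp
  also have "\<dots> \<le> 1/200 * (5 * (real K * real z))"
    using \<epsilon> by (intro mult_right_mono) auto
  also have "\<dots> = M"
    by (simp add: M_def)
  finally have E2_le: "real (card E2) \<le> M" .
  have "real (card ?E3) \<le> \<epsilon> * real (card E2)"
    using ED E2_nsets by (intro expander_decomposition_card_inter_cluster_edges) auto
  also have "\<dots> \<le> \<epsilon> * M"
    using E2_le \<epsilon> by simp
  also have "\<dots> \<le> 1 / real t * M"
    using \<epsilon> par \<open>M \<ge> 0\<close> by (intro mult_right_mono) (auto simp: field_simps)
  finally have E3_le: "real (card ?E3) \<le> 1 / real t * M" .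
  have "real (card {e \<in> asked q. (e \<in> X) \<noteq> (\<exists>Q\<in>Us ! 1. e \<subseteq> Q)}) \<le>
      ?c * real (card E2) + real (card ?E3)"
    unfolding \<open>q = (b, p)\<close> using ED par bp X
    by (intro card_wrong_slots_le [where \<phi> = \<phi> and \<U> = "Us ! 0"])
      (auto simp: expander_decomposition_def E2_def)
  also have "\<dots> \<le> ?c * M + 1 / real t * M"
    using E2_le E3_le by (intro add_mono mult_left_mono) auto
  also have "\<dots> = real K / 40 * (real t + 2 * (real z / real t))"
    using par by (simp add: M_def field_simps)
  \<comment> \<open>Here \<open>z \<le> t\<^sup>2\<close> enters: it bounds \<open>z / t\<close> by
    \<open>t\<close>.\<close>
  also have "\<dots> \<le> real K / 40 * (4 * real t)"
  proof (intro mult_left_mono)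
    have "real z \<le> real (t\<^sup>2)"
      using par by (simp only: of_nat_le_iff)
    then have "real z / real t \<le> real t"
      using par by (simp add: divide_le_eq power2_eq_square)
    then show "real t + 2 * (real z / real t) \<le> 4 * real t"
      by simp
  qed simp
  finally have "real (10 * card {e \<in> asked q. (e \<in> X) \<noteq> (\<exists>Q\<in>Us ! 1. e \<subseteq> Q)}) \<le> real (K * t)"
    by simp
  then show ?thesis
    by (simp only: of_nat_le_iff mem_Collect_eq)
qed

end

section \<open>Choice of the parameters\<close>

lemma card_slots_le_space:
  assumes par: "2 \<le> t" "t \<le> z" "B * t \<le> z" "z \<le> t\<^sup>2" "0 < \<phi>" "2 < \<phi> * real z" "K * (6 * z) \<le> n"
    and \<epsilon>: "0 < \<epsilon>" "\<epsilon> * real t \<le> 1/200" and "2 \<le> l"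
    and alg: "computes_removal_ED_sequence A n l \<epsilon> \<phi> (9/10)" "uses_space A n s"
  shows "B * t * (K * t) \<le> 5 * (s + 1)"
proof -
  let ?L = "{x. valid K B t z x}"
  obtain f where f: "bij_betw f ?L {0..<card ?L}"
    using ex_bij_betw_finite_nat card_valid_le by blast
  have "card ?L \<le> K * (2 * (B * t) + 2 * z + 2 * t)"
    using card_valid_le by blast
  also have "\<dots> \<le> K * (6 * z)"
    using par by (intro mult_left_mono) auto
  finally have "card ?L \<le> n"
    using par by simp
  interpret hard_instance K B t z n f "inv_into ?L f"
  proof
    fix x assume "valid K B t z x"
    then show "f x < n" "inv_into ?L f (f x) = x"
      using bij_betwE [OF f] \<open>card ?L \<le> n\<close> f
      by (auto simp: bij_betw_def dest!: bspec [of _ _ x])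
  qed
  have "card slots \<le> 5 * (s + 1)"
  proof (rule card_le_space_of_decoding [OF alg(2) slots_nsets, where Qs = "{..<B} \<times> {..<t}"
        and bob = bob and T = asked and \<tau> = "K * t"
        and good = "removal_ED_sequence l \<epsilon> \<phi> {..<n}" and dec = "\<lambda>q Us. {e. \<exists>Q\<in>Us ! 1. e \<subseteq> Q}"])
    show "slots = (\<Union>q\<in>{..<B} \<times> {..<t}. asked q)"
      by (simp add: slots_def)
    show "9/10 \<le> measure_pmf.prob A {D. removal_ED_sequence l \<epsilon> \<phi> {..<n} E (run D \<sigma>)}"
      if "E \<subseteq> [{..<n}]\<^bsup>2\<^esup>" "stream_of E \<sigma>" for E \<sigma>
      using alg(1) that by (simp add: computes_removal_ED_sequence_def)
    show "10 * card {e \<in> asked q. (e \<in> X) \<noteq> (e \<in> {e. \<exists>Q\<in>Us ! 1. e \<subseteq> Q})} \<le> K * t"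
      if "X \<subseteq> slots" "q \<in> {..<B} \<times> {..<t}" "removal_ED_sequence l \<epsilon> \<phi> {..<n} (X \<union> bob q) Us" for X q Us
      using removal_ED_sequence_decoding [OF that(1,2) par(1-6) \<epsilon> \<open>2 \<le> l\<close> that(3)] .
  qed (simp_all add: bob_nsets bob_disjoint_slots disjoint_asked card_asked del: mem_Sigma_iff)
  then show ?thesis
    by (simp only: card_slots)
qed

text \<open>Take \<open>t\<close> about \<open>1 / (200 * \<epsilon>)\<close>, \<open>z\<close> just
  above \<open>2 / \<phi>\<close>, \<open>B\<close> about \<open>z / t\<close> blocks per group and
  \<open>K\<close> about \<open>n / (6 * z)\<close> groups. Rounding down \<open>B\<close> and
  \<open>K\<close> loses a factor of at most 2 each, which leaves at least \<open>n * t / 24\<close>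
  bits.\<close>

lemma hard_instance_parameters:
  fixes \<epsilon> \<phi> :: real
  assumes "0 < \<epsilon>" "0 < \<phi>" "\<phi> < 1" "\<phi> \<le> \<epsilon>" and \<phi>: "10^6 * \<epsilon>\<^sup>2 \<le> \<phi>" "10^6 / real n \<le> \<phi>" and "n \<ge> 1"
  obtains K B t z where "2 \<le> t" "t \<le> z" "B * t \<le> z" "z \<le> t\<^sup>2" "2 < \<phi> * real z" "K * (6 * z) \<le> n"
    "\<epsilon> * real t \<le> 1/200" "real n / (400 * \<epsilon>) \<le> 24 * real (B * t * (K * t))"
proof -
  define t where "t = nat \<lfloor>1 / (200 * \<epsilon>)\<rfloor>"
  define z where "z = nat \<lfloor>2 / \<phi>\<rfloor> + 1"
  \<comment> \<open>From \<open>10^6 * \<epsilon>\<^sup>2 \<le> \<phi> \<le> \<epsilon>\<close>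
    follows \<open>\<epsilon> \<le> 1 / 10^6\<close>, so rounding hardly affects
    \<open>t\<close>.\<close>
  have "10^6 * \<epsilon> * \<epsilon> \<le> 1 * \<epsilon>"
    using \<phi>(1) \<open>\<phi> \<le> \<epsilon>\<close> unfolding power2_eq_square by linarith
  then have \<epsilon>_le: "10^6 * \<epsilon> \<le> 1"
    using \<open>0 < \<epsilon>\<close> by (rule mult_right_le_imp_le)
  then have big: "5000 \<le> 1 / (200 * \<epsilon>)"
    using \<open>0 < \<epsilon>\<close> by (simp add: field_simps)
  then have t_le: "real t \<le> 1 / (200 * \<epsilon>)" and t_gt: "1 / (200 * \<epsilon>) - 1 < real t"
    unfolding t_def by linarith+
  have t_ge: "1 / (400 * \<epsilon>) \<le> real t"
  proof -
    have "1 / (400 * \<epsilon>) = 1 / (200 * \<epsilon>) / 2"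
      by simp
    then show ?thesis
      using big t_gt by linarith
  qed
  have "2 \<le> t"
    using big t_gt by linarith
  have inv: "1 / \<epsilon> \<le> 1 / \<phi>" "1 < 1 / \<phi>"
    using assms by (simp_all add: frac_le)
  have z_gt: "2 / \<phi> < real z"
    unfolding z_def by linarith
  have z_le: "real z \<le> 3 / \<phi>"
  proof -
    have "real z \<le> 2 / \<phi> + 1"
      unfolding z_def using \<open>0 < \<phi>\<close> by (simp add: of_nat_nat)
    also have "\<dots> \<le> 2 / \<phi> + 1 / \<phi>"
      using inv by simp
    finally show ?thesis
      by simp
  qed
  have "real t \<le> real z"
  proof -
    have "1 / (200 * \<epsilon>) \<le> 2 / \<phi>"
      using inv assms by (simp add: field_simps)
    then show ?thesis
      using t_le z_gt by linarith
  qed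
  then have "t \<le> z"
    by simp
  have "real z \<le> (real t)\<^sup>2"
  proof -
    have "real z \<le> 3 / (10^6 * \<epsilon>\<^sup>2)"
      using z_le \<phi>(1) \<open>0 < \<epsilon>\<close> \<open>0 < \<phi>\<close> by (elim order.trans) (intro divide_left_mono, auto)
    also have "\<dots> \<le> (1 / (400 * \<epsilon>))\<^sup>2"
      using \<open>0 < \<epsilon>\<close> by (simp add: power_mult_distrib power_divide field_simps)
    also have "\<dots> \<le> (real t)\<^sup>2"
      using t_ge \<open>0 < \<epsilon>\<close> by (intro power_mono) auto
    finally show ?thesis .
  qed
  then have "z \<le> t\<^sup>2"
    by (simp flip: of_nat_power)
  define B where "B = z div t"
  define K where "K = n div (6 * z)"
  have "B * t \<le> z"
    by (simp add: B_def)
  have "z \<le> 2 * (B * t)"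
  proof -
    have "z mod t < t" "z = B * t + z mod t"
      using \<open>2 \<le> t\<close> by (simp_all add: B_def)
    moreover have "1 \<le> B"
      using \<open>t \<le> z\<close> \<open>2 \<le> t\<close> by (simp add: B_def div_greater_zero_iff Suc_le_eq)
    then have "t \<le> B * t"
      by simp
    ultimately show ?thesis
      by linarith
  qed
  \<comment> \<open>There is room for at least one group because \<open>\<phi>\<close> is at least
    \<open>10^6 / n\<close>.\<close>
  have "6 * z \<le> n"
  proof -
    have "real (6 * z) \<le> 18 / \<phi>"
      using z_le by simp
    also have "\<dots> \<le> 10^6 / \<phi>"
      using \<open>0 < \<phi>\<close> by (intro divide_right_mono) auto
    also have "\<dots> \<le> real n"
      using \<phi>(2) \<open>0 < \<phi>\<close> \<open>n \<ge> 1\<close> by (simp add: field_simps)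
    finally show ?thesis
      by (simp only: of_nat_le_iff)
  qed
  then have "n \<le> 2 * (K * (6 * z))"
  proof -
    have "0 < 6 * z"
      by (simp add: z_def)
    then have "n mod (6 * z) < 6 * z" "n = K * (6 * z) + n mod (6 * z)"
      by (simp_all only: K_def mod_less_divisor div_mult_mod_eq)
    moreover have "1 \<le> K"
      using \<open>6 * z \<le> n\<close> \<open>0 < 6 * z\<close> unfolding K_def by (simp only: div_greater_zero_iff Suc_le_eq One_nat_def)
    then have "6 * z \<le> K * (6 * z)"
      by (metis mult_le_mono1 nat_mult_1)
    ultimately show ?thesis
      by linarith
  qed
  then have "n * t \<le> 12 * z * (K * t)"
    using mult_le_mono1 [of n "2 * (K * (6 * z))" t] by (simp add: mult_ac)
  also have "\<dots> \<le> 12 * (2 * (B * t)) * (K * t)"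
    using \<open>z \<le> 2 * (B * t)\<close> by (intro mult_le_mono) auto
  finally have "n * t \<le> 24 * (B * t * (K * t))"
    by simp
  have "real n / (400 * \<epsilon>) = real n * (1 / (400 * \<epsilon>))"
    by simp
  also have "\<dots> \<le> real n * real t"
    by (intro mult_left_mono t_ge) simp
  also have "\<dots> \<le> real (24 * (B * t * (K * t)))"
    unfolding of_nat_mult [symmetric] of_nat_le_iff by fact
  finally have "real n / (400 * \<epsilon>) \<le> 24 * real (B * t * (K * t))"
    by simp
  moreover have "\<epsilon> * real t \<le> 1/200"
    using t_le \<open>0 < \<epsilon>\<close> by (simp add: field_simps)
  moreover have "2 < \<phi> * real z"
    using z_gt \<open>0 < \<phi>\<close> by (simp add: field_simps)
  moreover have "K * (6 * z) \<le> n"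
    by (simp only: K_def div_times_less_eq_dividend)
  ultimately show ?thesis
    using that \<open>2 \<le> t\<close> \<open>t \<le> z\<close> \<open>B * t \<le> z\<close> \<open>z \<le> t\<^sup>2\<close> by blast
qed

lemma removal_ED_sequence_space_ge:
  fixes \<epsilon> \<phi> :: real
  assumes "n \<ge> 1" "l \<ge> 2" "0 < \<epsilon>" "\<epsilon> < 1" "0 < \<phi>" "\<phi> < 1" "\<phi> \<le> \<epsilon>"
    and \<phi>: "10^6 * max (\<epsilon>\<^sup>2) (1 / real n) \<le> \<phi>"
    and alg: "computes_removal_ED_sequence A n l \<epsilon> \<phi> (9/10)" "uses_space A n s"
  shows "1 / 96000 * (real n / \<epsilon>) \<le> real s"
proof -
  have \<phi>': "10^6 * \<epsilon>\<^sup>2 \<le> \<phi>" "10^6 / real n \<le> \<phi>"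
    using \<phi> by (simp_all add: max_def split: if_splits)
  obtain K B t z where par: "2 \<le> t" "t \<le> z" "B * t \<le> z" "z \<le> t\<^sup>2" "2 < \<phi> * real z" "K * (6 * z) \<le> n"
    "\<epsilon> * real t \<le> 1/200" and N: "real n / (400 * \<epsilon>) \<le> 24 * real (B * t * (K * t))"
    by (rule hard_instance_parameters [OF assms(3,5,6,7) \<phi>' assms(1)])
  have "B * t * (K * t) \<le> 5 * (s + 1)"
    using card_slots_le_space [OF par(1-4) \<open>0 < \<phi>\<close> par(5,6) \<open>0 < \<epsilon>\<close> par(7) \<open>2 \<le> l\<close> alg] .
  then have "24 * real (B * t * (K * t)) \<le> 24 * real (5 * (s + 1))"
    by (intro mult_left_mono) (simp_all only: of_nat_le_iff)
  with N have up: "real n / (400 * \<epsilon>) \<le> 24 * real (5 * (s + 1))"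
    by linarith
  have "10^6 \<le> real n"
  proof -
    have "10^6 / real n \<le> 1"
      using \<phi>'(2) \<open>\<phi> < 1\<close> by linarith
    then show ?thesis
      using \<open>n \<ge> 1\<close> by (simp add: field_simps)
  qed
  also have "\<dots> \<le> real n / \<epsilon>"
    using assms by (simp add: field_simps mult_left_le)
  finally have "10^6 \<le> real n / \<epsilon>" .
  moreover have "real n / (400 * \<epsilon>) = real n / \<epsilon> / 400"
    by simp
  \<comment> \<open>Since \<open>24 * 5 * 400 = 48000\<close>, \<open>up\<close> gives
    \<open>s + 1 \<ge> n / (48000 * \<epsilon>)\<close>. As
    \<open>n / \<epsilon> \<ge> 10^6\<close>, the summand 1 is absorbed by halving the
    constant.\<close>
  ultimately show ?thesis
    using up by simp
qed

theorem theorem3: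
  "\<exists>C::real. C > 0 \<and>
     (\<forall>\<delta>::real. \<delta> > 0 \<longrightarrow>
       (\<exists>c::real. c > 0 \<and>
         (\<forall>(n::nat) (l::nat) (\<epsilon>::real) (\<phi>::real) (A::streaming_algorithm pmf) (s::nat).
            n \<ge> 1 \<longrightarrow> l \<ge> 2 \<longrightarrow>
            0 < \<epsilon> \<longrightarrow> \<epsilon> < 1 \<longrightarrow> 0 < \<phi> \<longrightarrow> \<phi> < 1 \<longrightarrow>
            \<epsilon> \<le> 1 - \<delta> \<longrightarrow> \<phi> \<le> \<epsilon> \<longrightarrow> \<phi> \<ge> C * max (\<epsilon>\<^sup>2) (1 / real n) \<longrightarrow>
            computes_removal_ED_sequence A n l \<epsilon> \<phi> (9 / 10) \<longrightarrow>
            uses_space A n s \<longrightarrow>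
            real s \<ge> c * (real n / \<epsilon>))))"
proof (rule exI [of _ "10^6"], intro conjI allI impI)
  show "\<exists>c::real. c > 0 \<and>
         (\<forall>(n::nat) (l::nat) (\<epsilon>::real) (\<phi>::real) (A::streaming_algorithm pmf) (s::nat).
            n \<ge> 1 \<longrightarrow> l \<ge> 2 \<longrightarrow>
            0 < \<epsilon> \<longrightarrow> \<epsilon> < 1 \<longrightarrow> 0 < \<phi> \<longrightarrow> \<phi> < 1 \<longrightarrow>
            \<epsilon> \<le> 1 - \<delta> \<longrightarrow> \<phi> \<le> \<epsilon> \<longrightarrow> \<phi> \<ge> 10^6 * max (\<epsilon>\<^sup>2) (1 / real n) \<longrightarrow>
            computes_removal_ED_sequence A n l \<epsilon> \<phi> (9 / 10) \<longrightarrow>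
            uses_space A n s \<longrightarrow>
            real s \<ge> c * (real n / \<epsilon>))" for \<delta>
    by (intro exI [of _ "1 / 96000"] conjI allI impI)
      (simp, rule removal_ED_sequence_space_ge, assumption+)
qed simp

end
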